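(* There is a polynomial-time algorithm that, given finite posets $\mathbb T$ and $\mathbb Q$ where $\mathbb T$ is a tree, decides whether there exists a surjective $p$-morphism from $\mathbb T$ onto $\mathbb Q$ (problem SPMorph) and decides whether $L(\mathbb T)\subseteq L(\mathbb Q)$ (problem LogContain).
   Context: A finite poset $\mathbb T$ is a tree if it has a least element (root) and for every $t$ the downset $\{s: s\leq t\}$ is a chain. A $p$-morphism $h\colon\mathbb P\to\mathbb Q$ is a map such that (HP) $x\leq y\Rightarrow h(x)\leq h(y)$ and (BP) whenever $h(x)\leq y$ there is $z\geq x$ with $h(z)=y$. $L(\mathbb P)$ denotes the set of formulas of propositional intuitionistic logic true at every point of $\mathbb P$ under every valuation, with $\mathbb P$ treated as an intuitionistic Kripke frame. *)

theory Defs
  imports "HOL-Computational_Algebra.Polynomial" "HOL-Library.FuncSet" "HOL-Library.Log_Nat"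
begin

section \<open>Posets, trees and p-morphisms\<close>

definition finite_poset :: "'a set \<Rightarrow> 'a rel \<Rightarrow> bool" where
  "finite_poset A r \<longleftrightarrow> finite A \<and> partial_order_on A r"

definition finite_tree :: "'a set \<Rightarrow> 'a rel \<Rightarrow> bool" where
  "finite_tree A r \<longleftrightarrow> finite_poset A r \<and> (\<exists>root\<in>A. \<forall>t\<in>A. (root, t) \<in> r) \<and>
     (\<forall>t\<in>A. {x \<in> A. (x, t) \<in> r} \<in> Chains r)"

definition p_morphism :: "'a set \<Rightarrow> 'a rel \<Rightarrow> 'b set \<Rightarrow> 'b rel \<Rightarrow> ('a \<Rightarrow> 'b) \<Rightarrow> bool" where
  "p_morphism A r B s h \<longleftrightarrow> h \<in> A \<rightarrow> B \<and>
     (\<forall>x\<in>A. \<forall>y\<in>A. (x, y) \<in> r \<longrightarrow> (h x, h y) \<in> s) \<and>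
     (\<forall>x\<in>A. \<forall>y\<in>B. (h x, y) \<in> s \<longrightarrow> (\<exists>z\<in>A. (x, z) \<in> r \<and> h z = y))"

definition has_surj_p_morphism :: "'a set \<Rightarrow> 'a rel \<Rightarrow> 'b set \<Rightarrow> 'b rel \<Rightarrow> bool" where
  "has_surj_p_morphism A r B s \<longleftrightarrow> (\<exists>h. p_morphism A r B s h \<and> h ` A = B)"


section \<open>Intuitionistic Kripke semantics\<close>

datatype fm = Var nat | Bot | And fm fm | Or fm fm | Imp fm fm

definition valuation :: "'a set \<Rightarrow> 'a rel \<Rightarrow> (nat \<Rightarrow> 'a set) \<Rightarrow> bool" where
  "valuation A r V \<longleftrightarrow>
     (\<forall>p. V p \<subseteq> A \<and> (\<forall>x\<in>V p. \<forall>y\<in>A. (x, y) \<in> r \<longrightarrow> y \<in> V p))"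

fun forces :: "'a set \<Rightarrow> 'a rel \<Rightarrow> (nat \<Rightarrow> 'a set) \<Rightarrow> 'a \<Rightarrow> fm \<Rightarrow> bool" where
  "forces A r V x (Var p) \<longleftrightarrow> x \<in> V p"
| "forces A r V x Bot \<longleftrightarrow> False"
| "forces A r V x (And a b) \<longleftrightarrow> forces A r V x a \<and> forces A r V x b"
| "forces A r V x (Or a b) \<longleftrightarrow> forces A r V x a \<or> forces A r V x b"
| "forces A r V x (Imp a b) \<longleftrightarrow>
     (\<forall>y\<in>A. (x, y) \<in> r \<longrightarrow> forces A r V y a \<longrightarrow> forces A r V y b)"

definition logic :: "'a set \<Rightarrow> 'a rel \<Rightarrow> fm set" where
  "logic A r = {\<phi>. \<forall>V. valuation A r V \<longrightarrow> (\<forall>x\<in>A. forces A r V x \<phi>)}"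


section \<open>Polynomial time\<close>

text \<open>
  The machine model is a random access machine with structured control flow, charged by the
  logarithmic cost criterion: every operation costs the number of bits of the addresses and
  values it handles. The only arithmetic operations are addition and truncated subtraction.
  Polynomial time on this model coincides with polynomial time on Turing machines.
\<close>

type_synonym mem = "nat \<Rightarrow> nat"

datatype exp = Const nat | Mem exp | Plus exp exp | Minus exp exp

fun eval :: "exp \<Rightarrow> mem \<Rightarrow> nat" where
  "eval (Const k) M = k"
| "eval (Mem e) M = M (eval e M)"
| "eval (Plus a b) M = eval a M + eval b M"
| "eval (Minus a b) M = eval a M - eval b M"

definition bits :: "nat \<Rightarrow> nat" where
  "bits k = 1 + floorlog 2 k"

text \<open>The bits of the address in a memory access are charged when the address is evaluated.\<close>

fun cost :: "exp \<Rightarrow> mem \<Rightarrow> nat" where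
  "cost (Const k) M = bits k"
| "cost (Mem e) M = cost e M + bits (M (eval e M))"
| "cost (Plus a b) M = cost a M + cost b M + bits (eval a M + eval b M)"
| "cost (Minus a b) M = cost a M + cost b M + bits (eval a M - eval b M)"

text \<open>
  \<open>Store a e\<close> writes the value of \<open>e\<close> to the cell whose address is the value of \<open>a\<close>.
  In tests, \<open>0\<close> means false and every other value means true.
\<close>

datatype com = Skip | Store exp exp | Seq com com | If exp com com | While exp com

text \<open>\<open>exec c M M' t\<close>: started in memory \<open>M\<close>, \<open>c\<close> halts in memory \<open>M'\<close> at total cost \<open>t\<close>.\<close>

inductive exec :: "com \<Rightarrow> mem \<Rightarrow> mem \<Rightarrow> nat \<Rightarrow> bool" where
  exec_Skip: "exec Skip M M 1"
| exec_Store: "exec (Store a e) M (M(eval a M := eval e M)) (1 + cost a M + cost e M)"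
| exec_Seq: "exec c M M' t \<Longrightarrow> exec d M' M'' u \<Longrightarrow> exec (Seq c d) M M'' (t + u)"
| exec_IfTrue: "eval e M \<noteq> 0 \<Longrightarrow> exec c M M' t \<Longrightarrow> exec (If e c d) M M' (1 + cost e M + t)"
| exec_IfFalse: "eval e M = 0 \<Longrightarrow> exec d M M' t \<Longrightarrow> exec (If e c d) M M' (1 + cost e M + t)"
| exec_WhileFalse: "eval e M = 0 \<Longrightarrow> exec (While e c) M M (1 + cost e M)"
| exec_WhileTrue: "eval e M \<noteq> 0 \<Longrightarrow> exec c M M' t \<Longrightarrow> exec (While e c) M' M'' u \<Longrightarrow>
     exec (While e c) M M'' (1 + cost e M + t + u)"

lemma exec_deterministic:
  assumes "exec c M M1 t1" and "exec c M M2 t2"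
  shows "M1 = M2 \<and> t1 = t2"
  using assms
proof (induction arbitrary: M2 t2 rule: exec.induct)
  case (exec_Skip M)
  from exec_Skip.prems show ?case by cases simp
next
  case (exec_Store a e M)
  from exec_Store.prems show ?case by cases simp
next
  case (exec_Seq c M M' t d M'' u)
  note IH = exec_Seq.IH
  from exec_Seq.prems show ?case
  proof cases
    case (exec_Seq N t' u')
    then show ?thesis using IH by metis
  qed
next
  case (exec_IfTrue e M c M' t d)
  note IH = exec_IfTrue.IH and hyps = exec_IfTrue.hyps
  from exec_IfTrue.prems show ?case
    by cases (use IH hyps in metis)+
next
  case (exec_IfFalse e M d M' t c)
  note IH = exec_IfFalse.IH and hyps = exec_IfFalse.hyps
  from exec_IfFalse.prems show ?case
    by cases (use IH hyps in metis)+
next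
  case (exec_WhileFalse e M c)
  from exec_WhileFalse.prems show ?case by cases (use exec_WhileFalse.hyps in simp_all)
next
  case (exec_WhileTrue e M c M' t M'' u)
  note IH = exec_WhileTrue.IH and hyps = exec_WhileTrue.hyps
  from exec_WhileTrue.prems show ?case
  proof cases
    case exec_WhileFalse
    then show ?thesis using hyps by simp
  next
    case (exec_WhileTrue N t' u')
    then show ?thesis using IH by metis
  qed
qed

text \<open>
  A binary word is kept in memory with its length in cell \<open>0\<close> and its symbols in the
  following cells. Initially, all cells not used by the input word are \<open>0\<close>.
\<close>

definition load :: "bool list \<Rightarrow> mem" where
  "load w = (\<lambda>i. if i = 0 then length w
                 else if i \<le> length w then of_bool (w ! (i - 1)) else 0)"

definition holds_word :: "mem \<Rightarrow> bool list \<Rightarrow> bool" where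
  "holds_word M w \<longleftrightarrow> M 0 = length w \<and> (\<forall>i<length w. M (Suc i) = of_bool (w ! i))"

text \<open>
  On every instance \<open>x \<in> D\<close>, presented as the binary word \<open>enc x\<close>, program \<open>c\<close> halts with
  output word \<open>f x\<close>, within time polynomial in the length of the input word.
\<close>

definition computes_in_poly_time ::
  "com \<Rightarrow> 'i set \<Rightarrow> ('i \<Rightarrow> bool list) \<Rightarrow> ('i \<Rightarrow> bool list) \<Rightarrow> bool" where
  "computes_in_poly_time c D enc f \<longleftrightarrow>
     (\<exists>p :: nat poly. \<forall>x\<in>D. \<exists>M t. exec c (load (enc x)) M t \<and>
        t \<le> poly p (length (enc x)) \<and> holds_word M (f x))"

text \<open>
  A relation on \<open>{..<n}\<close> is written as \<open>n\<close> in unary, a delimiter, and the \<open>n \<times> n\<close> incidence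
  matrix row by row. Up to isomorphism, every finite poset has a carrier of the form \<open>{..<n}\<close>.
\<close>

definition encode_rel :: "nat \<times> nat rel \<Rightarrow> bool list" where
  "encode_rel = (\<lambda>(n, r). replicate n True @ [False] @ [(i, j) \<in> r. i \<leftarrow> [0..<n], j \<leftarrow> [0..<n]])"

definition encode_pair :: "(nat \<times> nat rel) \<times> (nat \<times> nat rel) \<Rightarrow> bool list" where
  "encode_pair = (\<lambda>(P, Q). encode_rel P @ encode_rel Q)"

end

theory Submission
  imports Defs
begin

text \<open>
  For \<open>t\<close> in the tree and \<open>q\<close> in \<open>Q\<close>, ask whether some p-morphism from the upset of \<open>t\<close> to \<open>Q\<close>
  maps \<open>t\<close> to \<open>q\<close>. Since subtrees not needed can be sent to a maximal element above \<open>q\<close>, this is the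
  case iff it holds for some child of \<open>t\<close> and \<open>q\<close>, or the upper covers \<open>x\<close> of \<open>q\<close> can be matched
  injectively to children \<open>c\<close> of \<open>t\<close> such that it holds for \<open>c\<close> and \<open>x\<close>. The table of such pairs is
  computed by iterating this rule, deciding each bipartite matching problem by an auction.
  A surjective p-morphism exists iff \<open>Q\<close> has a least element that is reached from the root. By
  Jankov's theorem, the logic of the tree is contained in that of \<open>Q\<close> iff every \<open>q\<close> is reached from
  some \<open>t\<close>.

  Polynomial time is obtained once and for all by compiling a language whose only loops run
  through the numbers below the input length.
\<close>

section \<open>Unit-cost bounds\<close>

text \<open>Why a matching: the upsets of distinct children of t are disjoint, so p-morphisms on
  them can be chosen independently, but each child takes a single value. A p-morphism sending t to q
  and no child to q must therefore spend a separate child on every upper cover of q. Why an auction: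
  augmenting paths would need a search inside the loop language, whereas a bid is a local update of
  two arrays, and the sum of the prices measures progress. Why the input length L bounds every loop:
  prices are capped at n + 1, which exceeds the number of children of any of the n tree points. An
  auction thus takes at most n * (n + 1) bids, fewer than L because the n * n matrix is part of the
  input. The entries for t are final once as many rounds have passed as the upset of t has elements,
  and this is at most n < L. Containment of logics: if every q is reached, valuations on Q pull back
  along the p-morphisms. Conversely, a Jankov formula refuted at q in Q must be refuted in the tree,
  and the refuting valuation itself can be read as a p-morphism that attains q.\<close>

fun esize :: "exp \<Rightarrow> nat" where
  "esize (Const k) = k + 1"
| "esize (Mem e) = esize e + 1"
| "esize (Plus a b) = esize a + esize b + 1"
| "esize (Minus a b) = esize a + esize b + 1"

lemma bits_le:
  assumes "k \<le> 2 ^ j" shows "bits k \<le> j + 2"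
proof -
  have "k < 2 ^ (j + 1)"
    using assms by (rule order.strict_trans1) simp
  then have "floorlog 2 k \<le> j + 1"
    by (intro floorlog_leI) auto
  then show ?thesis by (simp add: bits_def)
qed

text \<open>This is why \<open>esize\<close> counts a constant by its value: k \<le> 2 ^ k. Addition
  at most doubles the larger operand, which costs one more unit.\<close>

lemma eval_le:
  assumes "\<forall>i. M i \<le> 2 ^ b" shows "eval e M \<le> 2 ^ (b + esize e)"
proof (induction e)
  case (Const k)
  have "k \<le> 2 ^ k" by (simp add: less_imp_le)
  also have "\<dots> \<le> 2 ^ (b + (k + 1))" by (intro power_increasing) auto
  finally show ?case by simp
next
  case (Mem e)
  have "(2::nat) ^ b \<le> 2 ^ (b + (esize e + 1))" by (intro power_increasing) auto
  with assms show ?case by (simp only: eval.simps esize.simps) (meson order_trans)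
next
  case (Plus a c)
  have "(2::nat) ^ (b + esize a) \<le> 2 ^ (b + esize a + esize c)"
    "(2::nat) ^ (b + esize c) \<le> 2 ^ (b + esize a + esize c)"
    by (intro power_increasing; simp)+
  with Plus have "eval a M + eval c M \<le> 2 * 2 ^ (b + esize a + esize c)" by linarith
  then show ?case by (simp add: ac_simps)
next
  case (Minus a c)
  have "(2::nat) ^ (b + esize a) \<le> 2 ^ (b + (esize a + esize c + 1))"
    by (intro power_increasing) auto
  with Minus.IH(1) show ?case by (simp only: eval.simps esize.simps)
qed

lemma cost_le:
  assumes "\<forall>i. M i \<le> 2 ^ b" shows "cost e M \<le> esize e * (b + esize e + 2)"
proof (induction e)
  case (Const k)
  have "bits k \<le> k + 2" by (intro bits_le) (simp add: less_imp_le)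
  then show ?case by simp
next
  case (Mem e)
  have "bits (M (eval e M)) \<le> b + 2" using assms by (intro bits_le) auto
  with Mem show ?case by (simp add: algebra_simps)
next
  case (Plus a c)
  have "bits (eval (Plus a c) M) \<le> b + esize (Plus a c) + 2"
    by (intro bits_le eval_le assms)
  with Plus show ?case by (simp add: algebra_simps)
next
  case (Minus a c)
  have "bits (eval (Minus a c) M) \<le> b + esize (Minus a c) + 2"
    by (intro bits_le eval_le assms)
  with Minus show ?case by (simp add: algebra_simps)
qed

text \<open>
  A unit-cost time bound \<open>u\<close>: since each unit at most doubles the largest value in memory, it
  yields a logarithmic-cost bound that is quadratic in \<open>u\<close>.
\<close>

definition runs :: "com \<Rightarrow> mem \<Rightarrow> mem \<Rightarrow> nat \<Rightarrow> bool" where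
  "runs c M M' u \<longleftrightarrow> (\<forall>b. (\<forall>i. M i \<le> 2 ^ b) \<longrightarrow>
     (\<forall>i. M' i \<le> 2 ^ (b + u)) \<and> (\<exists>t. exec c M M' t \<and> t \<le> u * (b + u + 2)))"

lemma runsI:
  assumes "\<And>b. \<forall>i. M i \<le> 2 ^ b \<Longrightarrow> \<forall>i. M' i \<le> 2 ^ (b + u)"
    and "\<And>b. \<forall>i. M i \<le> 2 ^ b \<Longrightarrow> \<exists>t. exec c M M' t \<and> t \<le> u * (b + u + 2)"
  shows "runs c M M' u"
  using assms by (simp add: runs_def)

lemma runs_bound:
  assumes "runs c M M' u" "\<forall>i. M i \<le> 2 ^ b"
  shows "\<forall>i. M' i \<le> 2 ^ (b + u)"
  using assms by (simp add: runs_def)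

lemma runs_exec:
  assumes "runs c M M' u" "\<forall>i. M i \<le> 2 ^ b"
  obtains t where "exec c M M' t" "t \<le> u * (b + u + 2)"
  using assms by (auto simp: runs_def)

lemma runs_mono:
  assumes "runs c M M' u" "u \<le> v" shows "runs c M M' v"
proof (rule runsI)
  fix b assume b: "\<forall>i. M i \<le> 2 ^ b"
  have "(2::nat) ^ (b + u) \<le> 2 ^ (b + v)" using assms(2) by (intro power_increasing) auto
  with runs_bound[OF assms(1) b] show "\<forall>i. M' i \<le> 2 ^ (b + v)" by (meson order_trans)
  obtain t where t: "exec c M M' t" "t \<le> u * (b + u + 2)" using runs_exec[OF assms(1) b] .
  have "u * (b + u + 2) \<le> v * (b + v + 2)" using assms(2) by (intro mult_mono) auto
  with t show "\<exists>t. exec c M M' t \<and> t \<le> v * (b + v + 2)" by (meson order_trans)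
qed

lemma runs_Skip: "runs Skip M M 1"
proof (rule runsI)
  fix b :: nat assume b: "\<forall>i. M i \<le> 2 ^ b"
  have "(2::nat) ^ b \<le> 2 ^ (b + 1)" by (intro power_increasing) auto
  with b show "\<forall>i. M i \<le> 2 ^ (b + 1)" by (meson order_trans)
  show "\<exists>t. exec Skip M M t \<and> t \<le> 1 * (b + 1 + 2)" using exec_Skip by force
qed

lemma runs_Store: "runs (Store a e) M (M(eval a M := eval e M)) (1 + esize a + esize e)"
proof (rule runsI)
  fix b :: nat assume b: "\<forall>i. M i \<le> 2 ^ b"
  have "(2::nat) ^ b \<le> 2 ^ (b + (1 + esize a + esize e))"
    "(2::nat) ^ (b + esize e) \<le> 2 ^ (b + (1 + esize a + esize e))"
    by (intro power_increasing; simp)+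
  then show "\<forall>i. (M(eval a M := eval e M)) i \<le> 2 ^ (b + (1 + esize a + esize e))"
    using b eval_le[OF b, of e] by (metis fun_upd_apply order_trans)
  have "1 + cost a M + cost e M \<le> (1 + esize a + esize e) * (b + (1 + esize a + esize e) + 2)"
    using cost_le[OF b, of a] cost_le[OF b, of e] by (simp add: algebra_simps)
  then show "\<exists>t. exec (Store a e) M (M(eval a M := eval e M)) t \<and>
      t \<le> (1 + esize a + esize e) * (b + (1 + esize a + esize e) + 2)"
    using exec_Store by blast
qed

text \<open>The second command starts from the bound b + u left by the first. The quadratic form
  absorbs this: u * (b + u + 2) + v * (b + u + v + 2) \<le> (u + v) * (b + (u + v) + 2). Hence unit
  costs simply add up.\<close>

lemma runs_Seq:
  assumes "runs c M M' u" "runs d M' M'' v" shows "runs (Seq c d) M M'' (u + v)"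
proof (rule runsI)
  fix b :: nat assume b: "\<forall>i. M i \<le> 2 ^ b"
  note b' = runs_bound[OF assms(1) b]
  show "\<forall>i. M'' i \<le> 2 ^ (b + (u + v))"
    using runs_bound[OF assms(2) b'] by (simp add: add.assoc)
  obtain t where t: "exec c M M' t" "t \<le> u * (b + u + 2)" using runs_exec[OF assms(1) b] .
  obtain t' where t': "exec d M' M'' t'" "t' \<le> v * (b + u + v + 2)"
    using runs_exec[OF assms(2) b'] .
  have "t + t' \<le> (u + v) * (b + (u + v) + 2)" using t(2) t'(2) by (simp add: algebra_simps)
  then show "\<exists>t. exec (Seq c d) M M'' t \<and> t \<le> (u + v) * (b + (u + v) + 2)"
    using exec_Seq[OF t(1) t'(1)] by blast
qed

lemma runs_If:
  assumes "runs (if eval e M \<noteq> 0 then c else d) M M' u"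
  shows "runs (If e c d) M M' (1 + esize e + u)"
proof (rule runsI)
  fix b :: nat assume b: "\<forall>i. M i \<le> 2 ^ b"
  have "(2::nat) ^ (b + u) \<le> 2 ^ (b + (1 + esize e + u))" by (intro power_increasing) auto
  then show "\<forall>i. M' i \<le> 2 ^ (b + (1 + esize e + u))"
    using runs_bound[OF assms b] by (meson order_trans)
  obtain t where t: "exec (if eval e M \<noteq> 0 then c else d) M M' t" "t \<le> u * (b + u + 2)"
    using runs_exec[OF assms b] .
  have "1 + cost e M + t \<le> (1 + esize e + u) * (b + (1 + esize e + u) + 2)"
    using cost_le[OF b, of e] t(2) by (simp add: algebra_simps)
  moreover have "exec (If e c d) M M' (1 + cost e M + t)"
    using t(1) exec_IfTrue[of e M c M' t d] exec_IfFalse[of e M d M' t c] by (auto split: if_splits)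
  ultimately show "\<exists>t. exec (If e c d) M M' t \<and>
      t \<le> (1 + esize e + u) * (b + (1 + esize e + u) + 2)"
    by blast
qed

lemma runs_WhileFalse:
  assumes "eval e M = 0" shows "runs (While e c) M M (1 + esize e)"
proof (rule runsI)
  fix b :: nat assume b: "\<forall>i. M i \<le> 2 ^ b"
  have "(2::nat) ^ b \<le> 2 ^ (b + (1 + esize e))" by (intro power_increasing) auto
  with b show "\<forall>i. M i \<le> 2 ^ (b + (1 + esize e))" by (meson order_trans)
  have "1 + cost e M \<le> (1 + esize e) * (b + (1 + esize e) + 2)"
    using cost_le[OF b, of e] by (simp add: algebra_simps)
  then show "\<exists>t. exec (While e c) M M t \<and> t \<le> (1 + esize e) * (b + (1 + esize e) + 2)"
    using exec_WhileFalse[of e M c, OF assms] by blast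
qed

lemma runs_WhileTrue:
  assumes "eval e M \<noteq> 0" "runs c M M' u" "runs (While e c) M' M'' v"
  shows "runs (While e c) M M'' (1 + esize e + u + v)"
proof (rule runsI)
  fix b :: nat assume b: "\<forall>i. M i \<le> 2 ^ b"
  note b' = runs_bound[OF assms(2) b]
  have "(2::nat) ^ (b + u + v) \<le> 2 ^ (b + (1 + esize e + u + v))"
    by (intro power_increasing) auto
  then show "\<forall>i. M'' i \<le> 2 ^ (b + (1 + esize e + u + v))"
    using runs_bound[OF assms(3) b'] by (meson order_trans)
  obtain t where t: "exec c M M' t" "t \<le> u * (b + u + 2)" using runs_exec[OF assms(2) b] .
  obtain t' where t': "exec (While e c) M' M'' t'" "t' \<le> v * (b + u + v + 2)"
    using runs_exec[OF assms(3) b'] .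
  have "1 + cost e M + t + t' \<le> (1 + esize e + u + v) * (b + (1 + esize e + u + v) + 2)"
    using cost_le[OF b, of e] t(2) t'(2) by (simp add: algebra_simps)
  then show "\<exists>t. exec (While e c) M M'' t \<and>
      t \<le> (1 + esize e + u + v) * (b + (1 + esize e + u + v) + 2)"
    using exec_WhileTrue[OF assms(1) t(1) t'(1)] by blast
qed

text \<open>Unit costs of the rounds add up, so no bound on the growth of memory has to be carried
  through the loop. The induction is on the number k of rounds left, which enters the loop at round
  N - k.\<close>

lemma runs_While_count:
  assumes step: "\<And>i M. i < N \<Longrightarrow> P i M \<Longrightarrow> eval e M \<noteq> 0 \<and> (\<exists>M'. runs c M M' u \<and> P (Suc i) M')"
    and final: "\<And>M. P N M \<Longrightarrow> eval e M = 0"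
    and init: "P 0 M"
  shows "\<exists>M'. runs (While e c) M M' (1 + esize e + N * (1 + esize e + u)) \<and> P N M'"
proof -
  have "\<exists>M'. runs (While e c) M M' (1 + esize e + k * (1 + esize e + u)) \<and> P N M'"
    if "k \<le> N" "P (N - k) M" for k M
    using that
  proof (induction k arbitrary: M)
    case 0
    then have "eval e M = 0" using final by simp
    from runs_WhileFalse[OF this] show ?case using 0 by auto
  next
    case (Suc k)
    then have "N - Suc k < N" "Suc (N - Suc k) = N - k" by auto
    then obtain M' where M': "eval e M \<noteq> 0" "runs c M M' u" "P (N - k) M'"
      using step[of "N - Suc k" M] Suc.prems(2) by auto
    with Suc obtain M'' where M'': "runs (While e c) M' M'' (1 + esize e + k * (1 + esize e + u))"
      "P N M''" by (meson Suc_leD)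
    from runs_WhileTrue[OF M'(1,2) M''(1)] show ?case
      using M''(2) by (auto simp: algebra_simps)
  qed
  from this[of N M] init show ?thesis by simp
qed

section \<open>Programs with loops bounded by the input length\<close>

text \<open>\<open>Sum\<close> is the only binder of terms: it provides bounded quantifiers and the
  multiplication that the machine lacks.\<close>

datatype tm = Num nat | Loc nat | Inp tm | Arr tm | Add tm tm | Sub tm tm | Ite tm tm tm | Sum nat tm

text \<open>
  The input \<open>I\<close> serves both as the input word and, through \<open>I 0\<close>, as the bound of all loops, so
  that every program of this language runs in polynomial time.
\<close>

fun tval :: "mem \<Rightarrow> tm \<Rightarrow> (nat \<Rightarrow> nat) \<Rightarrow> (nat \<Rightarrow> nat) \<Rightarrow> nat" where
  "tval I (Num k) \<sigma> s = k"
| "tval I (Loc x) \<sigma> s = \<sigma> x"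
| "tval I (Inp t) \<sigma> s = I (tval I t \<sigma> s)"
| "tval I (Arr t) \<sigma> s = s (tval I t \<sigma> s)"
| "tval I (Add a b) \<sigma> s = tval I a \<sigma> s + tval I b \<sigma> s"
| "tval I (Sub a b) \<sigma> s = tval I a \<sigma> s - tval I b \<sigma> s"
| "tval I (Ite a b c) \<sigma> s = (if tval I a \<sigma> s \<noteq> 0 then tval I b \<sigma> s else tval I c \<sigma> s)"
| "tval I (Sum x t) \<sigma> s = (\<Sum>i<I 0. tval I t (\<sigma>(x := i)) s)"

datatype prog = Write tm tm | Then prog prog | When tm prog | Loop nat prog

fun sem :: "mem \<Rightarrow> prog \<Rightarrow> (nat \<Rightarrow> nat) \<Rightarrow> (nat \<Rightarrow> nat) \<Rightarrow> (nat \<Rightarrow> nat)" where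
  "sem I (Write a e) \<sigma> s = s(tval I a \<sigma> s := tval I e \<sigma> s)"
| "sem I (Then c d) \<sigma> s = sem I d \<sigma> (sem I c \<sigma> s)"
| "sem I (When t c) \<sigma> s = (if tval I t \<sigma> s \<noteq> 0 then sem I c \<sigma> s else s)"
| "sem I (Loop x c) \<sigma> s = fold (\<lambda>i. sem I c (\<sigma>(x := i))) [0..<I 0] s"

text \<open>
  Cells \<open>0\<close> to \<open>I 0\<close> hold the input throughout. They are followed by \<open>R\<close> registers, used as a
  stack, and then by the array. The map \<open>\<rho>\<close> gives the register of each variable, and \<open>h\<close> is the
  first free register.
\<close>

abbreviation len :: exp where "len \<equiv> Mem (Const 0)"

abbreviation addr :: "nat \<Rightarrow> exp" where "addr h \<equiv> Plus len (Const (Suc h))"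

abbreviation reg :: "nat \<Rightarrow> exp" where "reg h \<equiv> Mem (addr h)"

text \<open>The result is left in register h, and subterms use only registers from h on. For
  \<open>Sum\<close>, register h accumulates, register h + 1 counts and is the bound variable, and
  register h + 2 receives the summand. The test in the \<open>Inp\<close> case succeeds iff the
  address is at most the input length: beyond it lie registers and array, where the initial input
  has zeros.\<close>

fun ctm :: "nat \<Rightarrow> (nat \<Rightarrow> nat) \<Rightarrow> nat \<Rightarrow> tm \<Rightarrow> com" where
  "ctm R \<rho> h (Num k) = Store (addr h) (Const k)"
| "ctm R \<rho> h (Loc x) = Store (addr h) (reg (\<rho> x))"
| "ctm R \<rho> h (Inp t) = Seq (ctm R \<rho> h t)
     (If (Minus (Plus len (Const 1)) (reg h)) (Store (addr h) (Mem (reg h))) (Store (addr h) (Const 0)))"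
| "ctm R \<rho> h (Arr t) = Seq (ctm R \<rho> h t) (Store (addr h) (Mem (Plus (addr R) (reg h))))"
| "ctm R \<rho> h (Add a b) = Seq (ctm R \<rho> h a) (Seq (ctm R \<rho> (Suc h) b)
     (Store (addr h) (Plus (reg h) (reg (Suc h)))))"
| "ctm R \<rho> h (Sub a b) = Seq (ctm R \<rho> h a) (Seq (ctm R \<rho> (Suc h) b)
     (Store (addr h) (Minus (reg h) (reg (Suc h)))))"
| "ctm R \<rho> h (Ite a b c) = Seq (ctm R \<rho> h a) (If (reg h) (ctm R \<rho> h b) (ctm R \<rho> h c))"
| "ctm R \<rho> h (Sum x t) = Seq (Store (addr h) (Const 0)) (Seq (Store (addr (Suc h)) (Const 0))
     (While (Minus len (reg (Suc h))) (Seq (ctm R (\<rho>(x := Suc h)) (Suc (Suc h)) t)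
       (Seq (Store (addr h) (Plus (reg h) (reg (Suc (Suc h)))))
         (Store (addr (Suc h)) (Plus (reg (Suc h)) (Const 1)))))))"

fun cprog :: "nat \<Rightarrow> (nat \<Rightarrow> nat) \<Rightarrow> nat \<Rightarrow> prog \<Rightarrow> com" where
  "cprog R \<rho> h (Write a e) = Seq (ctm R \<rho> h a) (Seq (ctm R \<rho> (Suc h) e)
     (Store (Plus (addr R) (reg h)) (reg (Suc h))))"
| "cprog R \<rho> h (Then c d) = Seq (cprog R \<rho> h c) (cprog R \<rho> h d)"
| "cprog R \<rho> h (When t c) = Seq (ctm R \<rho> h t) (If (reg h) (cprog R \<rho> h c) Skip)"
| "cprog R \<rho> h (Loop x c) = Seq (Store (addr h) (Const 0))
     (While (Minus len (reg h)) (Seq (cprog R (\<rho>(x := h)) (Suc h) c)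
       (Store (addr h) (Plus (reg h) (Const 1)))))"

text \<open>Sums in place of maxima overestimate the stack depth, which affects only the constant
  R.\<close>

fun tm_regs :: "tm \<Rightarrow> nat" where
  "tm_regs (Num k) = 1"
| "tm_regs (Loc x) = 1"
| "tm_regs (Inp t) = tm_regs t"
| "tm_regs (Arr t) = tm_regs t"
| "tm_regs (Add a b) = tm_regs a + tm_regs b + 1"
| "tm_regs (Sub a b) = tm_regs a + tm_regs b + 1"
| "tm_regs (Ite a b c) = tm_regs a + tm_regs b + tm_regs c"
| "tm_regs (Sum x t) = tm_regs t + 2"

fun prog_regs :: "prog \<Rightarrow> nat" where
  "prog_regs (Write a e) = tm_regs a + tm_regs e + 1"
| "prog_regs (Then c d) = prog_regs c + prog_regs d"
| "prog_regs (When t c) = tm_regs t + prog_regs c"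
| "prog_regs (Loop x c) = prog_regs c + 1"

text \<open>
  Register numbers are constants below \<open>R + 2\<close>, and constants count with their value, so the code
  surrounding the recursive calls has size linear in \<open>R\<close>.
\<close>

abbreviation unit_cost :: "nat \<Rightarrow> nat" where "unit_cost R \<equiv> 8 * R + 80"

fun tm_time :: "nat \<Rightarrow> tm \<Rightarrow> nat poly" where
  "tm_time R (Num k) = [:unit_cost R + k:]"
| "tm_time R (Loc x) = [:unit_cost R:]"
| "tm_time R (Inp t) = tm_time R t + [:unit_cost R:]"
| "tm_time R (Arr t) = tm_time R t + [:unit_cost R:]"
| "tm_time R (Add a b) = tm_time R a + tm_time R b + [:unit_cost R:]"
| "tm_time R (Sub a b) = tm_time R a + tm_time R b + [:unit_cost R:]"
| "tm_time R (Ite a b c) = tm_time R a + tm_time R b + tm_time R c + [:unit_cost R:]"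
| "tm_time R (Sum x t) = [:unit_cost R:] + [:0, 1:] * (tm_time R t + [:unit_cost R:])"

fun prog_time :: "nat \<Rightarrow> prog \<Rightarrow> nat poly" where
  "prog_time R (Write a e) = tm_time R a + tm_time R e + [:unit_cost R:]"
| "prog_time R (Then c d) = prog_time R c + prog_time R d"
| "prog_time R (When t c) = tm_time R t + prog_time R c + [:unit_cost R:]"
| "prog_time R (Loop x c) = [:unit_cost R:] + [:0, 1:] * (prog_time R c + [:unit_cost R:])"

section \<open>Correctness and running time of compiled programs\<close>

definition represents ::
  "nat \<Rightarrow> mem \<Rightarrow> (nat \<Rightarrow> nat) \<Rightarrow> nat \<Rightarrow> (nat \<Rightarrow> nat) \<Rightarrow> (nat \<Rightarrow> nat) \<Rightarrow> mem \<Rightarrow> bool" where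
  "represents R I \<rho> h \<sigma> s M \<longleftrightarrow> (\<forall>a\<le>I 0. M a = I a) \<and>
     (\<forall>j. M (Suc (I 0 + R + j)) = s j) \<and> (\<forall>x. \<rho> x < h \<and> M (Suc (I 0 + \<rho> x)) = \<sigma> x)"

text \<open>Register h is cell L + h + 1, so exactly the registers h to R - 1 may change: the stack
  space that \<open>represents\<close> leaves unconstrained at level h.\<close>

definition only_regs :: "nat \<Rightarrow> nat \<Rightarrow> nat \<Rightarrow> mem \<Rightarrow> mem \<Rightarrow> bool" where
  "only_regs L h R M M' \<longleftrightarrow> (\<forall>a. a \<le> L + h \<or> L + R < a \<longrightarrow> M' a = M a)"

lemma only_regs_refl [simp]: "only_regs L h R M M"
  by (simp add: only_regs_def)

lemma only_regs_trans:
  "only_regs L h R M M' \<Longrightarrow> only_regs L h' R M' M'' \<Longrightarrow> h \<le> h' \<Longrightarrow> only_regs L h R M M''"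
  by (simp add: only_regs_def)

lemma only_regs_upd:
  "h \<le> h' \<Longrightarrow> h' < R \<Longrightarrow> only_regs L h R M M' \<Longrightarrow> only_regs L h R M (M'(Suc (L + h') := v))"
  by (simp add: only_regs_def)

lemma represents_only_regs:
  assumes "represents R I \<rho> h \<sigma> s M" "only_regs (I 0) h' R M M'" "h \<le> h'" "h \<le> h''"
  shows "represents R I \<rho> h'' \<sigma> s M'"
  unfolding represents_def
proof (intro conjI allI impI)
  fix x
  have x: "\<rho> x < h" "M (Suc (I 0 + \<rho> x)) = \<sigma> x" using assms(1) by (auto simp: represents_def)
  show "\<rho> x < h''" using x assms(4) by simp
  show "M' (Suc (I 0 + \<rho> x)) = \<sigma> x" using x assms(2,3) by (simp add: only_regs_def)
qed (use assms in \<open>auto simp: represents_def only_regs_def\<close>)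

lemma represents_bind:
  assumes "represents R I \<rho> h \<sigma> s M" "M (Suc (I 0 + k)) = v" "h \<le> h'" "k < h'"
  shows "represents R I (\<rho>(x := k)) h' (\<sigma>(x := v)) s M"
  using assms unfolding represents_def by (auto intro: order.strict_trans2)

lemma represents_len: "represents R I \<rho> h \<sigma> s M \<Longrightarrow> M 0 = I 0"
  by (simp add: represents_def)

lemma represents_loc: "represents R I \<rho> h \<sigma> s M \<Longrightarrow> M (Suc (I 0 + \<rho> x)) = \<sigma> x"
  by (simp add: represents_def)

lemma tm_regs_pos: "0 < tm_regs t"
  by (induction t) auto

lemma runs_StoreI:
  assumes "eval a M = i" "eval e M = v" "1 + esize a + esize e \<le> u"
  shows "runs (Store a e) M (M(i := v)) u"
  using runs_mono[OF runs_Store assms(3)] assms(1,2) by blast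

lemma runs_SeqI:
  assumes "runs c M M' u" "runs d M' M'' v" "u + v \<le> w" shows "runs (Seq c d) M M'' w"
  using runs_mono[OF runs_Seq] assms by blast

lemma runs_IfI:
  assumes "runs (if eval e M \<noteq> 0 then c else d) M M' u" "1 + esize e + u \<le> w"
  shows "runs (If e c d) M M' w"
  using runs_mono[OF runs_If] assms by blast

lemma runs_store_result:
  assumes "runs c M (M1(Suc (L + h) := v)) u" "only_regs L h R M M1" "h < R"
  shows "\<exists>M'. runs c M M' u \<and> M' (Suc (L + h)) = v \<and> only_regs L h R M M'"
  using assms only_regs_upd[OF order_refl assms(3,2)] by (metis fun_upd_same)

text \<open>The bound on h keeps the stack below the array, and the zeros of I beyond cell I 0 match
  the guard in the \<open>Inp\<close> case. The time bound depends on the input length alone,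
  because both branches of \<open>Ite\<close> are charged and \<open>Sum\<close> always runs I 0
  rounds.\<close>

lemma runs_ctm:
  assumes "represents R I \<rho> h \<sigma> s M" "h + tm_regs t \<le> R" "\<forall>a>I 0. I a = 0"
  shows "\<exists>M'. runs (ctm R \<rho> h t) M M' (poly (tm_time R t) (I 0)) \<and>
    M' (Suc (I 0 + h)) = tval I t \<sigma> s \<and> only_regs (I 0) h R M M'"
  using assms(1,2)
proof (induction t arbitrary: \<rho> h \<sigma> M)
  case (Num k)
  have "runs (ctm R \<rho> h (Num k)) M (M(Suc (I 0 + h) := k)) (poly (tm_time R (Num k)) (I 0))"
    using Num represents_len[OF Num(1)] by (auto intro!: runs_StoreI)
  from runs_store_result[OF this] show ?case using Num(2) by simp
next
  case (Loc x)
  have "\<rho> x < h" using Loc(1) by (simp add: represents_def)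
  then have "runs (ctm R \<rho> h (Loc x)) M (M(Suc (I 0 + h) := \<sigma> x)) (poly (tm_time R (Loc x)) (I 0))"
    using Loc(2) represents_len[OF Loc(1)] represents_loc[OF Loc(1)] by (auto intro!: runs_StoreI)
  from runs_store_result[OF this] show ?case using Loc(2) by simp
next
  case (Inp t)
  have h: "h < R" using Inp.prems(2) tm_regs_pos[of t] by simp
  obtain M1 where M1: "runs (ctm R \<rho> h t) M M1 (poly (tm_time R t) (I 0))"
    "M1 (Suc (I 0 + h)) = tval I t \<sigma> s" "only_regs (I 0) h R M M1"
    using Inp by fastforce
  have rep: "represents R I \<rho> h \<sigma> s M1" using represents_only_regs[OF Inp.prems(1) M1(3)] by simp
  let ?v = "tval I t \<sigma> s"
  have "runs (If (Minus (Plus len (Const 1)) (reg h)) (Store (addr h) (Mem (reg h)))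
      (Store (addr h) (Const 0))) M1 (M1(Suc (I 0 + h) := I ?v)) (unit_cost R)"
  proof (rule runs_IfI)
    show "runs (if eval (Minus (Plus len (Const 1)) (reg h)) M1 \<noteq> 0 then Store (addr h) (Mem (reg h))
      else Store (addr h) (Const 0)) M1 (M1(Suc (I 0 + h) := I ?v)) (2 * R + 40)"
      using assms(3) rep M1(2) h by (auto intro!: runs_StoreI simp: represents_def)
  qed (use h in simp)
  then have "runs (ctm R \<rho> h (Inp t)) M (M1(Suc (I 0 + h) := I ?v)) (poly (tm_time R (Inp t)) (I 0))"
    unfolding ctm.simps by (rule runs_SeqI[OF M1(1)]) simp
  from runs_store_result[OF this] show ?case using h M1(3) by simp
next
  case (Arr t)
  have h: "h < R" using Arr.prems(2) tm_regs_pos[of t] by simp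
  obtain M1 where M1: "runs (ctm R \<rho> h t) M M1 (poly (tm_time R t) (I 0))"
    "M1 (Suc (I 0 + h)) = tval I t \<sigma> s" "only_regs (I 0) h R M M1"
    using Arr by fastforce
  have rep: "represents R I \<rho> h \<sigma> s M1" using represents_only_regs[OF Arr.prems(1) M1(3)] by simp
  let ?v = "tval I t \<sigma> s"
  have "runs (Store (addr h) (Mem (Plus (addr R) (reg h)))) M1 (M1(Suc (I 0 + h) := s ?v)) (unit_cost R)"
    using rep M1(2) h by (auto intro!: runs_StoreI simp: represents_def)
  then have "runs (ctm R \<rho> h (Arr t)) M (M1(Suc (I 0 + h) := s ?v)) (poly (tm_time R (Arr t)) (I 0))"
    unfolding ctm.simps by (rule runs_SeqI[OF M1(1)]) simp
  from runs_store_result[OF this] show ?case using h M1(3) by simp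
next
  case (Add a b)
  have h: "Suc h < R" using Add.prems(2) tm_regs_pos[of a] tm_regs_pos[of b] by simp
  obtain M1 where M1: "runs (ctm R \<rho> h a) M M1 (poly (tm_time R a) (I 0))"
    "M1 (Suc (I 0 + h)) = tval I a \<sigma> s" "only_regs (I 0) h R M M1"
    using Add.IH(1)[OF Add.prems(1)] Add.prems(2) by auto
  have rep: "represents R I \<rho> (Suc h) \<sigma> s M1" using represents_only_regs[OF Add.prems(1) M1(3)] by simp
  obtain M2 where M2: "runs (ctm R \<rho> (Suc h) b) M1 M2 (poly (tm_time R b) (I 0))"
    "M2 (Suc (I 0 + Suc h)) = tval I b \<sigma> s" "only_regs (I 0) (Suc h) R M1 M2"
    using Add.IH(2)[OF rep] Add.prems(2) by auto
  have "M2 (Suc (I 0 + h)) = tval I a \<sigma> s" "M2 0 = I 0"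
    using M2(3) M1(2) represents_len[OF rep] by (auto simp: only_regs_def)
  then have "runs (Store (addr h) (Plus (reg h) (reg (Suc h)))) M2
      (M2(Suc (I 0 + h) := tval I (Add a b) \<sigma> s)) (unit_cost R)"
    using M2(2) h by (auto intro!: runs_StoreI)
  then have "runs (ctm R \<rho> h (Add a b)) M (M2(Suc (I 0 + h) := tval I (Add a b) \<sigma> s)) (poly (tm_time R (Add a b)) (I 0))"
    unfolding ctm.simps by (rule runs_SeqI[OF M1(1) runs_SeqI[OF M2(1) _ order_refl]]) simp
  from runs_store_result[OF this] show ?case using h only_regs_trans[OF M1(3) M2(3)] by simp
next
  case (Sub a b)
  have h: "Suc h < R" using Sub.prems(2) tm_regs_pos[of a] tm_regs_pos[of b] by simp
  obtain M1 where M1: "runs (ctm R \<rho> h a) M M1 (poly (tm_time R a) (I 0))"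
    "M1 (Suc (I 0 + h)) = tval I a \<sigma> s" "only_regs (I 0) h R M M1"
    using Sub.IH(1)[OF Sub.prems(1)] Sub.prems(2) by auto
  have rep: "represents R I \<rho> (Suc h) \<sigma> s M1" using represents_only_regs[OF Sub.prems(1) M1(3)] by simp
  obtain M2 where M2: "runs (ctm R \<rho> (Suc h) b) M1 M2 (poly (tm_time R b) (I 0))"
    "M2 (Suc (I 0 + Suc h)) = tval I b \<sigma> s" "only_regs (I 0) (Suc h) R M1 M2"
    using Sub.IH(2)[OF rep] Sub.prems(2) by auto
  have "M2 (Suc (I 0 + h)) = tval I a \<sigma> s" "M2 0 = I 0"
    using M2(3) M1(2) represents_len[OF rep] by (auto simp: only_regs_def)
  then have "runs (Store (addr h) (Minus (reg h) (reg (Suc h)))) M2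
      (M2(Suc (I 0 + h) := tval I (Sub a b) \<sigma> s)) (unit_cost R)"
    using M2(2) h by (auto intro!: runs_StoreI)
  then have "runs (ctm R \<rho> h (Sub a b)) M (M2(Suc (I 0 + h) := tval I (Sub a b) \<sigma> s)) (poly (tm_time R (Sub a b)) (I 0))"
    unfolding ctm.simps by (rule runs_SeqI[OF M1(1) runs_SeqI[OF M2(1) _ order_refl]]) simp
  from runs_store_result[OF this] show ?case using h only_regs_trans[OF M1(3) M2(3)] by simp
next
  case (Ite a b c)
  have h: "h < R" using Ite.prems(2) tm_regs_pos[of a] by simp
  obtain M1 where M1: "runs (ctm R \<rho> h a) M M1 (poly (tm_time R a) (I 0))"
    "M1 (Suc (I 0 + h)) = tval I a \<sigma> s" "only_regs (I 0) h R M M1"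
    using Ite.IH(1)[OF Ite.prems(1)] Ite.prems(2) by auto
  have rep: "represents R I \<rho> h \<sigma> s M1" using represents_only_regs[OF Ite.prems(1) M1(3)] by simp
  define d where "d = (if tval I a \<sigma> s \<noteq> 0 then b else c)"
  have "\<exists>M2. runs (ctm R \<rho> h d) M1 M2 (poly (tm_time R d) (I 0)) \<and>
    M2 (Suc (I 0 + h)) = tval I d \<sigma> s \<and> only_regs (I 0) h R M1 M2"
    using Ite.IH(2,3)[OF rep] Ite.prems(2) by (auto simp: d_def)
  then obtain M2 where M2: "runs (ctm R \<rho> h d) M1 M2 (poly (tm_time R d) (I 0))"
    "M2 (Suc (I 0 + h)) = tval I d \<sigma> s" "only_regs (I 0) h R M1 M2" by blast
  have "runs (If (reg h) (ctm R \<rho> h b) (ctm R \<rho> h c)) M1 M2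
      (poly (tm_time R b + tm_time R c + [:unit_cost R:]) (I 0))"
    by (rule runs_IfI[where u = "poly (tm_time R d) (I 0)"])
      (use M2(1) represents_len[OF rep] M1(2) h in \<open>auto simp: d_def\<close>)
  from runs_SeqI[OF M1(1) this]
  have "runs (ctm R \<rho> h (Ite a b c)) M M2 (poly (tm_time R (Ite a b c)) (I 0))"
    by (simp add: add.assoc)
  then show ?case
    using M2(2) only_regs_trans[OF M1(3) M2(3)] by (intro exI[where x = M2]) (simp add: d_def)
next
  case (Sum x t)
  let ?a = "Suc (I 0 + h)" and ?b = "Suc (I 0 + Suc h)"
  have h: "Suc (Suc h) < R" using Sum.prems(2) tm_regs_pos[of t] by simp
  \<comment> \<open>Cell ?a is the accumulator; cell ?b is both the loop counter and the value of
    x.\<close>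
  define P where "P i N \<longleftrightarrow> only_regs (I 0) h R M N \<and>
    N ?a = (\<Sum>j<i. tval I t (\<sigma>(x := j)) s) \<and> N ?b = i" for i N
  let ?body = "Seq (ctm R (\<rho>(x := Suc h)) (Suc (Suc h)) t)
       (Seq (Store (addr h) (Plus (reg h) (reg (Suc (Suc h)))))
         (Store (addr (Suc h)) (Plus (reg (Suc h)) (Const 1))))"
  have P_len: "N 0 = I 0" if "P i N" for i N
    using that represents_len[OF Sum.prems(1)] by (simp add: P_def only_regs_def)
  let ?M0 = "M(?a := 0, ?b := 0)"
  have "\<exists>M'. runs (While (Minus len (reg (Suc h))) ?body) ?M0 M'
      (1 + esize (Minus len (reg (Suc h))) + I 0 * (1 + esize (Minus len (reg (Suc h))) +
        (poly (tm_time R t) (I 0) + (6 * R + 40)))) \<and> P (I 0) M'"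
  proof (rule runs_While_count)
    show "P 0 ?M0" using h by (simp add: P_def only_regs_def)
    show "eval (Minus len (reg (Suc h))) N = 0" if "P (I 0) N" for N
      using that P_len[OF that] by (simp add: P_def)
    fix i N assume i: "i < I 0" and N: "P i N"
    have "represents R I \<rho> h \<sigma> s N"
      using represents_only_regs[OF Sum.prems(1)] N by (auto simp: P_def)
    then have rep: "represents R I (\<rho>(x := Suc h)) (Suc (Suc h)) (\<sigma>(x := i)) s N"
      by (rule represents_bind) (use N in \<open>auto simp: P_def\<close>)
    obtain N1 where N1: "runs (ctm R (\<rho>(x := Suc h)) (Suc (Suc h)) t) N N1 (poly (tm_time R t) (I 0))"
      "N1 (Suc (I 0 + Suc (Suc h))) = tval I t (\<sigma>(x := i)) s" "only_regs (I 0) (Suc (Suc h)) R N N1"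
      using Sum.IH[OF rep] Sum.prems(2) by (auto simp del: fun_upd_apply)
    have N1': "N1 ?a = N ?a" "N1 ?b = N ?b" "N1 0 = I 0"
      using N1(3) P_len[OF N] by (auto simp: only_regs_def)
    define N2 where "N2 = N1(?a := N ?a + tval I t (\<sigma>(x := i)) s)"
    have r2: "runs (Store (addr h) (Plus (reg h) (reg (Suc (Suc h))))) N1 N2 (4 * R + 20)"
      unfolding N2_def using N1(2) N1' h by (auto intro!: runs_StoreI)
    have r3: "runs (Store (addr (Suc h)) (Plus (reg (Suc h)) (Const 1))) N2 (N2(?b := Suc i)) (2 * R + 20)"
      using N1' h N by (auto intro!: runs_StoreI simp: N2_def P_def)
    have "runs ?body N (N2(?b := Suc i)) (poly (tm_time R t) (I 0) + (6 * R + 40))"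
      by (rule runs_SeqI[OF N1(1) runs_SeqI[OF r2 r3 order_refl]]) simp
    moreover have "P (Suc i) (N2(?b := Suc i))"
    proof -
      have "only_regs (I 0) h R M N1"
        using N N1(3) by (auto simp: P_def elim!: only_regs_trans)
      then have "only_regs (I 0) h R M (N2(?b := Suc i))"
        using h unfolding N2_def by (intro only_regs_upd) auto
      then show ?thesis using N by (simp add: P_def N2_def)
    qed
    ultimately show "eval (Minus len (reg (Suc h))) N \<noteq> 0 \<and>
        (\<exists>M'. runs ?body N M' (poly (tm_time R t) (I 0) + (6 * R + 40)) \<and> P (Suc i) M')"
      using i N P_len[OF N] by (auto simp: P_def)
  qed
  then obtain M' where M': "runs (While (Minus len (reg (Suc h))) ?body) ?M0 M'
      (1 + esize (Minus len (reg (Suc h))) + I 0 * (1 + esize (Minus len (reg (Suc h))) +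
        (poly (tm_time R t) (I 0) + (6 * R + 40))))" "P (I 0) M'" by blast
  have s1: "runs (Store (addr h) (Const 0)) M (M(?a := 0)) (R + 20)"
    using represents_len[OF Sum.prems(1)] h by (auto intro!: runs_StoreI)
  have s2: "runs (Store (addr (Suc h)) (Const 0)) (M(?a := 0)) ?M0 (R + 20)"
    using represents_len[OF Sum.prems(1)] h by (auto intro!: runs_StoreI)
  \<comment> \<open>In every round, \<open>unit_cost R\<close> absorbs the loop test and the two
    register updates.\<close>
  have mult: "I 0 * (1 + esize (Minus len (reg (Suc h))) + (poly (tm_time R t) (I 0) + (6 * R + 40)))
      \<le> I 0 * (poly (tm_time R t) (I 0) + unit_cost R)"
    using h by (intro mult_left_mono) auto
  have "runs (ctm R \<rho> h (Sum x t)) M M' (poly (tm_time R (Sum x t)) (I 0))"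
    unfolding ctm.simps
    by (rule runs_SeqI[OF s1 runs_SeqI[OF s2 M'(1) order_refl]])
      (use mult h in \<open>simp add: algebra_simps\<close>)
  then show ?case using M'(2) by (auto simp: P_def)
qed

text \<open>The array is given by its contents rather than by its change, and registers from h on
  are left open, so that intermediate array states drop out in
  \<open>updates_array_trans\<close>.\<close>

definition updates_array :: "nat \<Rightarrow> nat \<Rightarrow> nat \<Rightarrow> (nat \<Rightarrow> nat) \<Rightarrow> mem \<Rightarrow> mem \<Rightarrow> bool" where
  "updates_array L h R s M M' \<longleftrightarrow> (\<forall>a\<le>L + h. M' a = M a) \<and> (\<forall>j. M' (Suc (L + R + j)) = s j)"

lemma represents_updates_array:
  assumes "represents R I \<rho> h \<sigma> s M" "updates_array (I 0) h R s' M M'"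
  shows "represents R I \<rho> h \<sigma> s' M'"
  using assms by (simp add: represents_def updates_array_def Suc_leI)

lemma updates_array_trans:
  assumes "updates_array L h R s M M'" "updates_array L h R s' M' M''"
  shows "updates_array L h R s' M M''"
  using assms by (simp add: updates_array_def)

lemma updates_array_only_regs:
  assumes "represents R I \<rho> h \<sigma> s M" "only_regs (I 0) h R M M'"
  shows "updates_array (I 0) h R s M M'"
  using assms by (simp add: represents_def updates_array_def only_regs_def)

lemma runs_cprog:
  assumes "represents R I \<rho> h \<sigma> s M" "h + prog_regs c \<le> R" "\<forall>a>I 0. I a = 0"
  shows "\<exists>M'. runs (cprog R \<rho> h c) M M' (poly (prog_time R c) (I 0)) \<and>
    updates_array (I 0) h R (sem I c \<sigma> s) M M'"
  using assms(1,2)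
proof (induction c arbitrary: \<rho> h \<sigma> s M)
  case (Write a e)
  have h: "Suc h < R" using Write.prems(2) tm_regs_pos[of a] tm_regs_pos[of e] by simp
  obtain M1 where M1: "runs (ctm R \<rho> h a) M M1 (poly (tm_time R a) (I 0))"
    "M1 (Suc (I 0 + h)) = tval I a \<sigma> s" "only_regs (I 0) h R M M1"
    using runs_ctm[OF Write.prems(1) _ assms(3), of a] Write.prems(2) by auto
  have rep1: "represents R I \<rho> (Suc h) \<sigma> s M1"
    using represents_only_regs[OF Write.prems(1) M1(3)] by simp
  obtain M2 where M2: "runs (ctm R \<rho> (Suc h) e) M1 M2 (poly (tm_time R e) (I 0))"
    "M2 (Suc (I 0 + Suc h)) = tval I e \<sigma> s" "only_regs (I 0) (Suc h) R M1 M2"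
    using runs_ctm[OF rep1 _ assms(3), of e] Write.prems(2) by auto
  have M2': "M2 (Suc (I 0 + h)) = tval I a \<sigma> s" using M1(2) M2(3) by (simp add: only_regs_def)
  have upd: "updates_array (I 0) h R s M M2"
    using updates_array_only_regs[OF Write.prems(1) only_regs_trans[OF M1(3) M2(3)]] by simp
  note rep = represents_updates_array[OF Write.prems(1) upd]
  let ?M3 = "M2(Suc (I 0 + R + tval I a \<sigma> s) := tval I e \<sigma> s)"
  have "runs (Store (Plus (addr R) (reg h)) (reg (Suc h))) M2 ?M3 (unit_cost R)"
    using M2(2) M2' represents_len[OF rep] h by (intro runs_StoreI) auto
  then have "runs (cprog R \<rho> h (Write a e)) M ?M3 (poly (prog_time R (Write a e)) (I 0))"
    unfolding cprog.simps by (rule runs_SeqI[OF M1(1) runs_SeqI[OF M2(1) _ order_refl]]) simp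
  moreover have "updates_array (I 0) h R (sem I (Write a e) \<sigma> s) M ?M3"
    using upd h by (simp add: updates_array_def)
  ultimately show ?case by blast
next
  case (Then c d)
  obtain M1 where M1: "runs (cprog R \<rho> h c) M M1 (poly (prog_time R c) (I 0))"
    "updates_array (I 0) h R (sem I c \<sigma> s) M M1"
    using Then.IH(1)[OF Then.prems(1)] Then.prems(2) by auto
  obtain M2 where M2: "runs (cprog R \<rho> h d) M1 M2 (poly (prog_time R d) (I 0))"
    "updates_array (I 0) h R (sem I d \<sigma> (sem I c \<sigma> s)) M1 M2"
    using Then.IH(2)[OF represents_updates_array[OF Then.prems(1) M1(2)]] Then.prems(2) by auto
  from runs_Seq[OF M1(1) M2(1)] updates_array_trans[OF M1(2) M2(2)] show ?case by auto
next
  case (When t c)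
  have h: "h < R" using When.prems(2) tm_regs_pos[of t] by simp
  obtain M1 where M1: "runs (ctm R \<rho> h t) M M1 (poly (tm_time R t) (I 0))"
    "M1 (Suc (I 0 + h)) = tval I t \<sigma> s" "only_regs (I 0) h R M M1"
    using runs_ctm[OF When.prems(1) _ assms(3), of t] When.prems(2) by auto
  note upd = updates_array_only_regs[OF When.prems(1) M1(3)]
  note rep = represents_updates_array[OF When.prems(1) upd]
  have "\<exists>M2. runs (if tval I t \<sigma> s \<noteq> 0 then cprog R \<rho> h c else Skip) M1 M2
      (poly (prog_time R c) (I 0) + 1) \<and> updates_array (I 0) h R (sem I (When t c) \<sigma> s) M M2"
  proof (cases "tval I t \<sigma> s = 0")
    case True
    have "runs Skip M1 M1 (poly (prog_time R c) (I 0) + 1)" by (rule runs_mono[OF runs_Skip]) simp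
    then show ?thesis using True upd by auto
  next
    case False
    obtain M2 where M2: "runs (cprog R \<rho> h c) M1 M2 (poly (prog_time R c) (I 0))"
      "updates_array (I 0) h R (sem I c \<sigma> s) M1 M2"
      using When.IH[OF rep] When.prems(2) by auto
    have "runs (cprog R \<rho> h c) M1 M2 (poly (prog_time R c) (I 0) + 1)"
      by (rule runs_mono[OF M2(1)]) simp
    then show ?thesis using False updates_array_trans[OF upd M2(2)] by auto
  qed
  then obtain M2 where M2: "runs (if tval I t \<sigma> s \<noteq> 0 then cprog R \<rho> h c else Skip) M1 M2
      (poly (prog_time R c) (I 0) + 1)" "updates_array (I 0) h R (sem I (When t c) \<sigma> s) M M2"
    by blast
  have "runs (If (reg h) (cprog R \<rho> h c) Skip) M1 M2 (poly (prog_time R c) (I 0) + unit_cost R)"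
    by (rule runs_IfI[where u = "poly (prog_time R c) (I 0) + 1"])
      (use M2(1) represents_len[OF rep] M1(2) h in auto)
  from runs_Seq[OF M1(1) this]
  have "runs (cprog R \<rho> h (When t c)) M M2 (poly (prog_time R (When t c)) (I 0))"
    by (simp add: add.assoc)
  with M2(2) show ?case by blast
next
  case (Loop x c)
  let ?a = "Suc (I 0 + h)"
  have h: "h < R" using Loop.prems(2) by simp
  define f where "f i = fold (\<lambda>i. sem I c (\<sigma>(x := i))) [0..<i] s" for i
  define P where "P i N \<longleftrightarrow> updates_array (I 0) h R (f i) M N \<and> N ?a = i" for i N
  let ?body = "Seq (cprog R (\<rho>(x := h)) (Suc h) c) (Store (addr h) (Plus (reg h) (Const 1)))"
  let ?g = "Minus len (reg h)"
  let ?M0 = "M(?a := 0)"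
  have P_len: "N 0 = I 0" if "P i N" for i N
    using that represents_len[OF Loop.prems(1)] by (simp add: P_def updates_array_def)
  have "\<exists>M'. runs (While ?g ?body) ?M0 M'
      (1 + esize ?g + I 0 * (1 + esize ?g + (poly (prog_time R c) (I 0) + (2 * R + 20)))) \<and> P (I 0) M'"
  proof (rule runs_While_count)
    show "P 0 ?M0" using Loop.prems(1) h by (simp add: P_def f_def updates_array_def represents_def)
    show "eval ?g N = 0" if "P (I 0) N" for N
      using that P_len[OF that] by (simp add: P_def)
    fix i N assume i: "i < I 0" and N: "P i N"
    have "represents R I \<rho> h \<sigma> (f i) N"
      using N represents_updates_array[OF Loop.prems(1)] by (simp add: P_def)
    then have rep: "represents R I (\<rho>(x := h)) (Suc h) (\<sigma>(x := i)) (f i) N"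
      by (rule represents_bind) (use N in \<open>auto simp: P_def\<close>)
    obtain N1 where N1: "runs (cprog R (\<rho>(x := h)) (Suc h) c) N N1 (poly (prog_time R c) (I 0))"
      "updates_array (I 0) (Suc h) R (sem I c (\<sigma>(x := i)) (f i)) N N1"
      using Loop.IH[OF rep] Loop.prems(2) by (auto simp del: fun_upd_apply)
    have N1': "N1 ?a = i" "N1 0 = I 0" using N N1(2) P_len[OF N] by (auto simp: updates_array_def P_def)
    have "runs (Store (addr h) (Plus (reg h) (Const 1))) N1 (N1(?a := Suc i)) (2 * R + 20)"
      using N1' h by (auto intro!: runs_StoreI)
    from runs_Seq[OF N1(1) this]
    have "runs ?body N (N1(?a := Suc i)) (poly (prog_time R c) (I 0) + (2 * R + 20))" .
    moreover have "sem I c (\<sigma>(x := i)) (f i) = f (Suc i)" by (simp add: f_def)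
    then have "P (Suc i) (N1(?a := Suc i))"
      using N N1(2) h by (auto simp: P_def updates_array_def)
    ultimately show "eval ?g N \<noteq> 0 \<and>
        (\<exists>M'. runs ?body N M' (poly (prog_time R c) (I 0) + (2 * R + 20)) \<and> P (Suc i) M')"
      using i N P_len[OF N] by (auto simp: P_def)
  qed
  then obtain M' where M': "runs (While ?g ?body) ?M0 M'
      (1 + esize ?g + I 0 * (1 + esize ?g + (poly (prog_time R c) (I 0) + (2 * R + 20))))" "P (I 0) M'"
    by blast
  have s1: "runs (Store (addr h) (Const 0)) M ?M0 (R + 20)"
    using represents_len[OF Loop.prems(1)] h by (auto intro!: runs_StoreI)
  have mult: "I 0 * (1 + esize ?g + (poly (prog_time R c) (I 0) + (2 * R + 20)))
      \<le> I 0 * (poly (prog_time R c) (I 0) + unit_cost R)"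
    using h by (intro mult_left_mono) auto
  have "runs (cprog R \<rho> h (Loop x c)) M M' (poly (prog_time R (Loop x c)) (I 0))"
    unfolding cprog.simps
    by (rule runs_SeqI[OF s1 M'(1)]) (use mult h in \<open>simp add: algebra_simps\<close>)
  then show ?case using M'(2) by (auto simp: P_def f_def)
qed

text \<open>
  The first register stays \<open>0\<close> and stands for all unbound variables. The output cell \<open>0\<close> is written
  last because it gives access to the array.
\<close>

lemma prog_computes_in_poly_time:
  assumes "\<And>x. x \<in> D \<Longrightarrow> sem (load (enc x)) c (\<lambda>_. 0) (\<lambda>_. 0) 0 = of_bool (f x)"
    and "\<And>x. x \<in> D \<Longrightarrow> sem (load (enc x)) c (\<lambda>_. 0) (\<lambda>_. 0) 1 = of_bool (g x)"
  shows "\<exists>c. computes_in_poly_time c D enc (\<lambda>x. [f x, g x])"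
proof -
  \<comment> \<open>Register 0 is spent on the unbound variables. The array starts at cell L + R + 1
    \<ge> 3 for input length L, clear of the output cells 1 and 2.\<close>
  define R where "R = prog_regs c + 2"
  define out where "out = Seq (Store (Const 1) (Mem (addr R)))
    (Seq (Store (Const 2) (Mem (Plus (addr R) (Const 1)))) (Store (Const 0) (Const 2)))"
  define w where "w = prog_time R c + [:unit_cost R:]"
  \<comment> \<open>This is the bound u * (b + u + 2) from \<open>runs\<close> with u = w and b = 1
    + L for input length L: every cell of the loaded input is at most 1 + L \<le> 2 ^ (1 +
    L).\<close>
  define p where "p = w * ([:3:] + [:0, 1:] + w)"
  have "\<exists>M t. exec (Seq (cprog R (\<lambda>_. 0) 1 c) out) (load (enc x)) M t \<and>
      t \<le> poly p (length (enc x)) \<and> holds_word M [f x, g x]" if x: "x \<in> D" for x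
  proof -
    let ?I = "load (enc x)" and ?L = "length (enc x)"
    let ?s = "sem ?I c (\<lambda>_. 0) (\<lambda>_. 0)"
    have I0: "?I 0 = ?L" by (simp add: load_def)
    have "represents R ?I (\<lambda>_. 0) 1 (\<lambda>_. 0) (\<lambda>_. 0) ?I"
      by (simp add: represents_def load_def)
    moreover have "\<forall>a>?I 0. ?I a = 0" by (simp add: load_def)
    ultimately obtain M1 where M1: "runs (cprog R (\<lambda>_. 0) 1 c) ?I M1 (poly (prog_time R c) ?L)"
      "updates_array ?L 1 R ?s ?I M1"
      using runs_cprog[of R ?I "\<lambda>_. 0" 1 "\<lambda>_. 0" "\<lambda>_. 0" ?I c] I0 by (auto simp: R_def)
    have M1_0: "M1 0 = ?L" using M1(2) I0 by (simp add: updates_array_def)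
    let ?M2 = "M1(1 := ?s 0, 2 := ?s 1, 0 := 2)"
    have arr: "M1 (Suc (?L + R)) = ?s 0" "M1 (Suc (Suc (?L + R))) = ?s 1"
      using M1(2)[unfolded updates_array_def, THEN conjunct2, rule_format, of 0]
        M1(2)[unfolded updates_array_def, THEN conjunct2, rule_format, of 1] by simp_all
    have r1: "runs (Store (Const 1) (Mem (addr R))) M1 (M1(1 := ?s 0)) (R + 20)"
      using M1_0 arr by (intro runs_StoreI) auto
    have r2: "runs (Store (Const 2) (Mem (Plus (addr R) (Const 1)))) (M1(1 := ?s 0))
        (M1(1 := ?s 0, 2 := ?s 1)) (R + 20)"
      using M1_0 arr by (intro runs_StoreI) (auto simp: R_def)
    have r3: "runs (Store (Const 0) (Const 2)) (M1(1 := ?s 0, 2 := ?s 1)) ?M2 10"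
      by (intro runs_StoreI) auto
    have "runs out M1 ?M2 (unit_cost R)"
      unfolding out_def by (rule runs_SeqI[OF r1 runs_SeqI[OF r2 r3 order_refl]]) simp
    from runs_Seq[OF M1(1) this]
    have run: "runs (Seq (cprog R (\<lambda>_. 0) 1 c) out) ?I ?M2 (poly w ?L)"
      by (simp add: w_def)
    have "?I i \<le> 2 ^ (1 + ?L)" for i
    proof -
      have "?I i \<le> 1 + ?L" by (simp add: load_def)
      also have "\<dots> \<le> 2 ^ (1 + ?L)" by (rule less_imp_le[OF less_exp])
      finally show ?thesis .
    qed
    then obtain t where "exec (Seq (cprog R (\<lambda>_. 0) 1 c) out) ?I ?M2 t"
      "t \<le> poly w ?L * (1 + ?L + poly w ?L + 2)"
      using runs_exec[OF run] by blast
    moreover have "poly w ?L * (1 + ?L + poly w ?L + 2) = poly p ?L" by (simp add: p_def algebra_simps)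
    moreover have "holds_word ?M2 [f x, g x]"
      using assms[OF x] by (auto simp: holds_word_def less_Suc_eq numeral_2_eq_2)
    ultimately show ?thesis by metis
  qed
  then show ?thesis unfolding computes_in_poly_time_def by blast
qed

section \<open>P-morphisms from trees\<close>

lemma finite_posetD:
  assumes "finite_poset A r"
  shows "finite A" "\<And>x. x \<in> A \<Longrightarrow> (x, x) \<in> r" "\<And>x y z. (x, y) \<in> r \<Longrightarrow> (y, z) \<in> r \<Longrightarrow> (x, z) \<in> r"
    "\<And>x y. (x, y) \<in> r \<Longrightarrow> (y, x) \<in> r \<Longrightarrow> x = y"
  using assms unfolding finite_poset_def partial_order_on_def preorder_on_def
  by (auto simp: refl_on_def dest: transD antisymD)

lemma finite_poset_converse: "finite_poset A r \<Longrightarrow> finite_poset A (r\<inverse>)"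
  by (simp add: finite_poset_def)

text \<open>Take a point of S with the smallest downset; a point of S strictly below it would have a
  smaller one.\<close>

lemma ex_minimal:
  assumes "finite_poset A r" "S \<subseteq> A" "S \<noteq> {}"
  shows "\<exists>m\<in>S. \<forall>y\<in>S. (y, m) \<in> r \<longrightarrow> y = m"
proof -
  note po = finite_posetD[OF assms(1)]
  define d where "d x = {z \<in> A. (z, x) \<in> r}" for x
  obtain m where m: "m \<in> S" "\<And>y. y \<in> S \<Longrightarrow> card (d m) \<le> card (d y)"
    using assms(3) ex_has_least_nat[of "\<lambda>x. x \<in> S" _ "\<lambda>x. card (d x)"] by blast
  have "y = m" if y: "y \<in> S" "(y, m) \<in> r" for y
  proof (rule ccontr)
    assume "y \<noteq> m"
    then have "m \<notin> d y" "m \<in> d m" "d y \<subseteq> d m"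
      using y m(1) assms(2) po(2,4) by (auto simp: d_def intro: po(3))
    then have "d y \<subset> d m" by blast
    moreover have "finite (d m)" using po(1) by (simp add: d_def)
    ultimately have "card (d y) < card (d m)" by (rule psubset_card_mono[rotated])
    then show False using m(2)[OF y(1)] by simp
  qed
  then show ?thesis using m(1) by blast
qed

lemma ex_maximal:
  assumes "finite_poset A r" "S \<subseteq> A" "S \<noteq> {}"
  shows "\<exists>m\<in>S. \<forall>y\<in>S. (m, y) \<in> r \<longrightarrow> y = m"
  using ex_minimal[OF finite_poset_converse[OF assms(1)] assms(2,3)] by simp

definition covers :: "'a set \<Rightarrow> 'a rel \<Rightarrow> 'a \<Rightarrow> 'a set" where
  "covers A r x = {y \<in> A. (x, y) \<in> r \<and> y \<noteq> x \<and> (\<forall>z\<in>A. (x, z) \<in> r \<longrightarrow> (z, y) \<in> r \<longrightarrow> z = x \<or> z = y)}"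

lemma coversD:
  assumes "y \<in> covers A r x" shows "y \<in> A" "(x, y) \<in> r" "y \<noteq> x"
  using assms by (auto simp: covers_def)

lemma ex_cover_below:
  assumes "finite_poset A r" "z \<in> A" "(x, z) \<in> r" "x \<noteq> z"
  shows "\<exists>y\<in>covers A r x. (y, z) \<in> r"
proof -
  note po = finite_posetD[OF assms(1)]
  let ?S = "{y \<in> A. (x, y) \<in> r \<and> y \<noteq> x \<and> (y, z) \<in> r}"
  have "z \<in> ?S" using assms po(2) by auto
  then obtain m where m: "m \<in> ?S" "\<And>y. y \<in> ?S \<Longrightarrow> (y, m) \<in> r \<Longrightarrow> y = m"
    using ex_minimal[OF assms(1), of ?S] by auto
  then have "m \<in> covers A r x" using po(3) unfolding covers_def by blast
  then show ?thesis using m(1) by blast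
qed

definition up_set :: "'a set \<Rightarrow> 'a rel \<Rightarrow> 'a \<Rightarrow> 'a set" where
  "up_set A r t = {z \<in> A. (t, z) \<in> r}"

definition rooted_p_morphism ::
  "'a set \<Rightarrow> 'a rel \<Rightarrow> 'b set \<Rightarrow> 'b rel \<Rightarrow> 'a \<Rightarrow> 'b \<Rightarrow> bool" where
  "rooted_p_morphism A r B s t q \<longleftrightarrow> (\<exists>h. p_morphism (up_set A r t) r B s h \<and> h t = q)"

lemma up_set_self: "finite_poset A r \<Longrightarrow> t \<in> A \<Longrightarrow> t \<in> up_set A r t"
  by (simp add: up_set_def finite_posetD)

lemma up_set_mono: "finite_poset A r \<Longrightarrow> (t, c) \<in> r \<Longrightarrow> up_set A r c \<subseteq> up_set A r t"
  unfolding up_set_def using finite_posetD(3) by fastforce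

lemma p_morphismD:
  assumes "p_morphism A r B s h"
  shows "x \<in> A \<Longrightarrow> h x \<in> B" "x \<in> A \<Longrightarrow> y \<in> A \<Longrightarrow> (x, y) \<in> r \<Longrightarrow> (h x, h y) \<in> s"
    "x \<in> A \<Longrightarrow> y' \<in> B \<Longrightarrow> (h x, y') \<in> s \<Longrightarrow> \<exists>z\<in>A. (x, z) \<in> r \<and> h z = y'"
  using assms by (auto simp: p_morphism_def)

lemma p_morphism_up_set:
  assumes "finite_poset A r" "p_morphism (up_set A r t) r B s h" "(t, c) \<in> r"
  shows "p_morphism (up_set A r c) r B s h"
proof -
  note sub = up_set_mono[OF assms(1,3)] and pm = p_morphismD[OF assms(2)]
  have "\<exists>z\<in>up_set A r c. (x, z) \<in> r \<and> h z = y"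
    if "x \<in> up_set A r c" "y \<in> B" "(h x, y) \<in> s" for x y
    using pm(3)[of x y] that sub finite_posetD(3)[OF assms(1)] unfolding up_set_def by blast
  then show ?thesis using pm(1,2) sub unfolding p_morphism_def by blast
qed

text \<open>At a maximal m the back condition asks only for m itself. This is the map used on
  branches that no cover of q needs.\<close>

lemma p_morphism_const_maximal:
  assumes "finite_poset A r" "m \<in> B" "(m, m) \<in> s" "\<And>y. y \<in> B \<Longrightarrow> (m, y) \<in> s \<Longrightarrow> y = m"
  shows "p_morphism (up_set A r t) r B s (\<lambda>_. m)"
  using assms finite_posetD(2)[OF assms(1)] by (fastforce simp: p_morphism_def up_set_def)

lemma finite_treeD:
  assumes "finite_tree A r"
  shows "finite_poset A r" "\<exists>root\<in>A. \<forall>t\<in>A. (root, t) \<in> r"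
    "\<And>x y t. x \<in> A \<Longrightarrow> y \<in> A \<Longrightarrow> t \<in> A \<Longrightarrow> (x, t) \<in> r \<Longrightarrow> (y, t) \<in> r \<Longrightarrow> (x, y) \<in> r \<or> (y, x) \<in> r"
  using assms unfolding finite_tree_def Chains_def by blast+

text \<open>Both covers lie below z, hence are comparable, and comparable covers of one element
  coincide. So the branches above t are disjoint, which is what allows gluing.\<close>

lemma tree_cover_unique:
  assumes "finite_tree A r" "c \<in> covers A r t" "d \<in> covers A r t" "z \<in> A" "(c, z) \<in> r" "(d, z) \<in> r"
  shows "c = d"
proof -
  have "(c, d) \<in> r \<or> (d, c) \<in> r"
    using finite_treeD(3)[OF assms(1) _ _ assms(4-6)] assms(2,3) by (auto dest: coversD)
  then show ?thesis using assms(2,3) unfolding covers_def by blast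
qed

text \<open>Each z \<noteq> t above t lies in exactly one branch, so the maps \<open>g c\<close>
  combine without conflict and only t needs care. Monotonicity from t holds because q is below every
  \<open>g c c\<close>. For the back condition at t, a point y strictly above q is above some cover
  of q; by the last hypothesis some \<open>g c c\<close> is then below y, and the back condition of
  \<open>g c\<close> applies.\<close>

lemma rooted_p_morphism_glue:
  assumes tree: "finite_tree A r" and B: "finite_poset B s" and t: "t \<in> A" and q: "q \<in> B"
    and g: "\<And>c. c \<in> covers A r t \<Longrightarrow> p_morphism (up_set A r c) r B s (g c) \<and> (q, g c c) \<in> s"
    and cov: "(\<exists>c\<in>covers A r t. g c c = q) \<or> (\<forall>x\<in>covers B s q. \<exists>c\<in>covers A r t. g c c = x)"
  shows "rooted_p_morphism A r B s t q"
proof -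
  note A = finite_treeD(1)[OF tree]
  note po = finite_posetD[OF A] and poB = finite_posetD[OF B]
  define child where "child z = (THE c. c \<in> covers A r t \<and> (c, z) \<in> r)" for z
  have child_eq: "child z = c" if "c \<in> covers A r t" "(c, z) \<in> r" "z \<in> A" for c z
    unfolding child_def using that tree_cover_unique[OF tree] by (intro the_equality) auto
  have child: "child z \<in> covers A r t \<and> (child z, z) \<in> r" if z: "z \<in> up_set A r t" "z \<noteq> t" for z
    using ex_cover_below[OF A, of z t] z child_eq[of _ z] by (auto simp: up_set_def)
  define h where "h z = (if z = t then q else g (child z) z)" for z
  have h_in: "h z = g c z" if "c \<in> covers A r t" "z \<in> up_set A r c" for c z
  proof -
    have "z \<noteq> t" using that po(4) coversD[OF that(1)] by (auto simp: up_set_def)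
    then show ?thesis using child_eq[OF that(1)] that(2) by (simp add: h_def up_set_def)
  qed
  have self: "z \<in> up_set A r (child z)" if z: "z \<in> up_set A r t" "z \<noteq> t" for z
    using child[OF z] z by (simp add: up_set_def)
  have c_self: "c \<in> up_set A r c" if "c \<in> covers A r t" for c
    using up_set_self[OF A] coversD(1)[OF that] .
  have "p_morphism (up_set A r t) r B s h"
    unfolding p_morphism_def
  proof (intro conjI ballI impI funcsetI)
    fix z assume z: "z \<in> up_set A r t"
    show "h z \<in> B"
    proof (cases "z = t")
      case False
      with child[OF z] self[OF z] g show ?thesis by (auto simp: h_def dest: p_morphismD(1))
    qed (simp add: h_def q)
  next
    fix x y assume x: "x \<in> up_set A r t" and y: "y \<in> up_set A r t" and xy: "(x, y) \<in> r"
    consider "y = t" | "x = t" "y \<noteq> t" | "x \<noteq> t" "y \<noteq> t" by blast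
    then show "(h x, h y) \<in> s"
    proof cases
      case 1
      then have "x = t" using x xy po(4) by (auto simp: up_set_def)
      then show ?thesis using 1 poB(2) q by (simp add: h_def)
    next
      case 2
      let ?c = "child y"
      have c: "?c \<in> covers A r t" "(?c, y) \<in> r" using child[OF y 2(2)] by auto
      have "(g ?c ?c, g ?c y) \<in> s"
        using p_morphismD(2)[of "up_set A r ?c" r B s "g ?c"] g[OF c(1)] c(2) c_self[OF c(1)] self[OF y 2(2)]
        by blast
      then show ?thesis using 2 g[OF c(1)] poB(3) by (auto simp: h_def)
    next
      case 3
      let ?c = "child x"
      have c: "?c \<in> covers A r t" "(?c, x) \<in> r" using child[OF x 3(1)] by auto
      have "y \<in> up_set A r ?c" using c(2) xy y po(3) by (auto simp: up_set_def)
      then show ?thesis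
        using h_in[OF c(1)] self[OF x 3(1)] p_morphismD(2)[of "up_set A r ?c" r B s "g ?c"] g[OF c(1)] xy
        by auto
    qed
  next
    fix x y assume x: "x \<in> up_set A r t" and y: "y \<in> B" and xy: "(h x, y) \<in> s"
    have onto: "\<exists>z\<in>up_set A r t. (w, z) \<in> r \<and> h z = y"
      if c: "c \<in> covers A r t" and w: "w \<in> up_set A r c" "(g c w, y) \<in> s" for c w
    proof -
      obtain z where "z \<in> up_set A r c" "(w, z) \<in> r" "g c z = y"
        using p_morphismD(3)[of "up_set A r c" r B s "g c" w y] g[OF c] w y by blast
      then show ?thesis
        using h_in[OF c] up_set_mono[OF A coversD(2)[OF c]] by blast
    qed
    show "\<exists>z\<in>up_set A r t. (x, z) \<in> r \<and> h z = y"
    proof (cases "x = t")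
      case False
      then show ?thesis using onto[OF _ self[OF x False]] child[OF x False] xy by (auto simp: h_def)
    next
      case True
      show ?thesis
      proof (cases "y = q")
        case True
        then show ?thesis using \<open>x = t\<close> t po(2) by (intro bexI[of _ t]) (auto simp: h_def up_set_def)
      next
        case False
        have qy: "(q, y) \<in> s" using xy True by (simp add: h_def)
        obtain c where c: "c \<in> covers A r t" "(g c c, y) \<in> s"
          using cov ex_cover_below[OF B y qy] False qy by auto
        obtain z where "z \<in> up_set A r t" "(c, z) \<in> r" "h z = y"
          using onto[OF c(1) c_self[OF c(1)] c(2)] by blast
        then show ?thesis using True by (auto simp: up_set_def)
      qed
    qed
  qed
  then show ?thesis unfolding rooted_p_morphism_def by (auto simp: h_def)
qed

text \<open>If h sends no child of t to q, take a cover x of q, a point z sent to x and the child c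
  below z: then h c lies between q and x, hence equals x. Distinct covers get distinct children
  because h has one value on each. Conversely, injectivity leaves each child with at most one cover,
  so a p-morphism can be chosen on each matched branch; all other branches go to a maximal m above
  q.\<close>

lemma rooted_p_morphism_rec:
  assumes tree: "finite_tree A r" and B: "finite_poset B s" and t: "t \<in> A" and q: "q \<in> B"
  shows "rooted_p_morphism A r B s t q \<longleftrightarrow>
    (\<exists>c\<in>covers A r t. rooted_p_morphism A r B s c q) \<or>
    (\<exists>f. inj_on f (covers B s q) \<and>
      (\<forall>x\<in>covers B s q. f x \<in> covers A r t \<and> rooted_p_morphism A r B s (f x) x))"
    (is "?L \<longleftrightarrow> ?R1 \<or> ?R2")
proof
  note A = finite_treeD(1)[OF tree]
  note po = finite_posetD[OF A] and poB = finite_posetD[OF B]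
  assume ?L
  then obtain h where h: "p_morphism (up_set A r t) r B s h" "h t = q"
    by (auto simp: rooted_p_morphism_def)
  have sub: "rooted_p_morphism A r B s c (h c)" if "c \<in> covers A r t" for c
    using p_morphism_up_set[OF A h(1) coversD(2)[OF that]] by (auto simp: rooted_p_morphism_def)
  have c_up: "c \<in> up_set A r t" if "c \<in> covers A r t" for c
    using coversD[OF that] by (simp add: up_set_def)
  show "?R1 \<or> ?R2"
  proof (cases "\<exists>c\<in>covers A r t. h c = q")
    case True
    then show ?thesis using sub by metis
  next
    case False
    have "\<exists>c\<in>covers A r t. h c = x" if x: "x \<in> covers B s q" for x
    proof -
      obtain z where z: "z \<in> up_set A r t" "h z = x"
        using p_morphismD(3)[OF h(1) up_set_self[OF A t] coversD(1)[OF x]] coversD(2)[OF x] h(2) by auto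
      then have "t \<noteq> z" using h(2) coversD(3)[OF x] by auto
      then obtain c where c: "c \<in> covers A r t" "(c, z) \<in> r"
        using ex_cover_below[OF A, of z t] z by (auto simp: up_set_def)
      have "(q, h c) \<in> s" "(h c, x) \<in> s"
        using p_morphismD(2)[OF h(1) up_set_self[OF A t] c_up[OF c(1)] coversD(2)[OF c(1)]]
          p_morphismD(2)[OF h(1) c_up[OF c(1)] z(1) c(2)] z(2) h(2) by auto
      moreover have "h c \<in> B" using p_morphismD(1)[OF h(1) c_up[OF c(1)]] .
      ultimately have "h c = x" using x False c(1) by (auto simp: covers_def)
      then show ?thesis using c(1) by blast
    qed
    then obtain f where f: "\<And>x. x \<in> covers B s q \<Longrightarrow> f x \<in> covers A r t \<and> h (f x) = x" by metis
    then have "inj_on f (covers B s q)" by (metis inj_onI)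
    then have ?R2 using f sub by metis
    then show ?thesis ..
  qed
next
  note A = finite_treeD(1)[OF tree]
  note poB = finite_posetD[OF B]
  obtain m where m: "m \<in> B" "(q, m) \<in> s" "\<And>y. y \<in> B \<Longrightarrow> (m, y) \<in> s \<Longrightarrow> y = m"
    using ex_maximal[OF B, of "{y \<in> B. (q, y) \<in> s}"] poB(2)[OF q] q poB(3) by blast
  note const = p_morphism_const_maximal[OF A m(1) poB(2)[OF m(1)] m(3)]
  assume "?R1 \<or> ?R2"
  then show ?L
  proof
    assume ?R1
    then obtain c h where c: "c \<in> covers A r t" "p_morphism (up_set A r c) r B s h" "h c = q"
      by (auto simp: rooted_p_morphism_def)
    show ?L
    proof (rule rooted_p_morphism_glue[OF tree B t q])
      let ?g = "\<lambda>d. if d = c then h else (\<lambda>_. m)"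
      show "p_morphism (up_set A r d) r B s (?g d) \<and> (q, ?g d d) \<in> s" for d
        using c const m(2) poB(2)[OF q] by simp
      show "(\<exists>d\<in>covers A r t. ?g d d = q) \<or> (\<forall>x\<in>covers B s q. \<exists>d\<in>covers A r t. ?g d d = x)"
        using c by auto
    qed
  next
    assume ?R2
    then obtain f where f: "inj_on f (covers B s q)"
      "\<And>x. x \<in> covers B s q \<Longrightarrow> f x \<in> covers A r t \<and> rooted_p_morphism A r B s (f x) x" by auto
    then obtain h where h:
      "\<And>x. x \<in> covers B s q \<Longrightarrow> p_morphism (up_set A r (f x)) r B s (h x) \<and> h x (f x) = x"
      unfolding rooted_p_morphism_def by metis
    define g where "g d = (if d \<in> f ` covers B s q then h (the_inv_into (covers B s q) f d) else (\<lambda>_. m))"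
      for d
    have g: "g (f x) = h x" if "x \<in> covers B s q" for x
      using that f(1) by (simp add: g_def the_inv_into_f_f)
    show ?L
    proof (rule rooted_p_morphism_glue[OF tree B t q])
      fix d
      show "p_morphism (up_set A r d) r B s (g d) \<and> (q, g d d) \<in> s"
      proof (cases "d \<in> f ` covers B s q")
        case True
        then show ?thesis using g h by (auto dest: coversD(2))
      next
        case False
        then show ?thesis using const m(2) by (simp add: g_def)
      qed
    next
      have "\<forall>x\<in>covers B s q. \<exists>d\<in>covers A r t. g d d = x" using f(2) g h by metis
      then show "(\<exists>d\<in>covers A r t. g d d = q) \<or> (\<forall>x\<in>covers B s q. \<exists>d\<in>covers A r t. g d d = x)" ..
    qed
  qed
qed

text \<open>The image of a p-morphism on the upset of t is exactly the upset of h t, so h is onto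
  iff h t is least.\<close>

lemma has_surj_p_morphism_iff:
  assumes A: "finite_poset A r" and B: "finite_poset B s" and root: "t \<in> A" "\<forall>x\<in>A. (t, x) \<in> r"
  shows "has_surj_p_morphism A r B s \<longleftrightarrow>
    (\<exists>q\<in>B. (\<forall>y\<in>B. (q, y) \<in> s) \<and> rooted_p_morphism A r B s t q)"
proof -
  have up: "up_set A r t = A" using root by (auto simp: up_set_def)
  have "h ` A = B \<longleftrightarrow> (\<forall>y\<in>B. (h t, y) \<in> s)" if h: "p_morphism A r B s h" for h
  proof
    assume "h ` A = B"
    then show "\<forall>y\<in>B. (h t, y) \<in> s" using p_morphismD(2)[OF h root(1)] root(2) by blast
  next
    assume "\<forall>y\<in>B. (h t, y) \<in> s"
    then show "h ` A = B" using p_morphismD(1)[OF h] p_morphismD(3)[OF h root(1)] by blast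
  qed
  moreover have "h t \<in> B" if "p_morphism A r B s h" for h using p_morphismD(1)[OF that root(1)] .
  ultimately have "(\<exists>h. p_morphism A r B s h \<and> h ` A = B) \<longleftrightarrow>
      (\<exists>h. p_morphism A r B s h \<and> h t \<in> B \<and> (\<forall>y\<in>B. (h t, y) \<in> s))"
    by metis
  then show ?thesis unfolding has_surj_p_morphism_def rooted_p_morphism_def up by metis
qed

text \<open>W is empty outside the upset of t and still a valuation on all of A, because that upset
  is upward closed; forcing at its points never looks outside it.\<close>

lemma forces_pullback:
  assumes A: "finite_poset A r" and h: "p_morphism (up_set A r t) r B s h" and V: "valuation B s V"
  defines "W \<equiv> \<lambda>p. {x \<in> up_set A r t. h x \<in> V p}"
  shows "valuation A r W" "x \<in> up_set A r t \<Longrightarrow> forces A r W x \<phi> \<longleftrightarrow> forces B s V (h x) \<phi>"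
proof -
  note po = finite_posetD[OF A]
  have up: "y \<in> up_set A r t" if "x \<in> up_set A r t" "y \<in> A" "(x, y) \<in> r" for x y
    using that po(3) by (auto simp: up_set_def)
  show "valuation A r W"
    unfolding valuation_def
  proof (intro allI conjI ballI impI)
    fix p show "W p \<subseteq> A" by (auto simp: W_def up_set_def)
    fix x y assume "x \<in> W p" "y \<in> A" "(x, y) \<in> r"
    then show "y \<in> W p"
      using up[of x y] p_morphismD(2)[OF h, of x y] p_morphismD(1)[OF h, of y] V
      unfolding W_def valuation_def by blast
  qed
  show "forces A r W x \<phi> \<longleftrightarrow> forces B s V (h x) \<phi>" if "x \<in> up_set A r t"
    using that
  proof (induction \<phi> arbitrary: x)
    case (Imp \<phi> \<psi>)
    note x = Imp.prems
    show ?case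
    proof
      assume L: "forces A r W x (Imp \<phi> \<psi>)"
      show "forces B s V (h x) (Imp \<phi> \<psi>)"
        unfolding forces.simps
      proof (intro ballI impI)
        fix y assume y: "y \<in> B" "(h x, y) \<in> s" "forces B s V y \<phi>"
        then obtain z where z: "z \<in> up_set A r t" "(x, z) \<in> r" "h z = y"
          using p_morphismD(3)[OF h x] by blast
        then show "forces B s V y \<psi>" using L Imp.IH y(3) by (auto simp: up_set_def)
      qed
    next
      assume R: "forces B s V (h x) (Imp \<phi> \<psi>)"
      show "forces A r W x (Imp \<phi> \<psi>)"
        unfolding forces.simps
      proof (intro ballI impI)
        fix y assume y: "y \<in> A" "(x, y) \<in> r" "forces A r W y \<phi>"
        note u = up[OF x y(1,2)]
        then show "forces A r W y \<psi>"
          using R Imp.IH[OF u] y p_morphismD(1)[OF h u] p_morphismD(2)[OF h x u y(2)] by auto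
      qed
    qed
  qed (auto simp: W_def)
qed

lemma logic_subset_if_rooted_p_morphism:
  assumes A: "finite_poset A r" and "\<And>q. q \<in> B \<Longrightarrow> \<exists>t\<in>A. rooted_p_morphism A r B s t q"
  shows "logic A r \<subseteq> logic B s"
  unfolding logic_def
proof (intro subsetI CollectI allI impI ballI)
  fix \<phi> V q assume \<phi>: "\<phi> \<in> {\<phi>. \<forall>V. valuation A r V \<longrightarrow> (\<forall>x\<in>A. forces A r V x \<phi>)}"
    and V: "valuation B s V" and q: "q \<in> B"
  obtain t h where t: "t \<in> A" "p_morphism (up_set A r t) r B s h" "h t = q"
    using assms(2)[OF q] by (auto simp: rooted_p_morphism_def)
  show "forces B s V q \<phi>"
    using forces_pullback[OF A t(2) V] \<phi> t up_set_self[OF A t(1)] by auto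
qed

section \<open>Jankov formulas\<close>

definition Disj :: "fm list \<Rightarrow> fm" where "Disj xs = foldr Or xs Bot"

definition Conj :: "fm list \<Rightarrow> fm" where "Conj xs = foldr And xs (Imp Bot Bot)"

lemma forces_Disj [simp]: "forces A r V x (Disj xs) \<longleftrightarrow> (\<exists>\<phi>\<in>set xs. forces A r V x \<phi>)"
  by (induction xs) (auto simp: Disj_def)

lemma forces_Conj [simp]: "forces A r V x (Conj xs) \<longleftrightarrow> (\<forall>\<phi>\<in>set xs. forces A r V x \<phi>)"
  by (induction xs) (auto simp: Conj_def)

definition some_var :: "nat set \<Rightarrow> fm" where "some_var S = Disj (map Var (sorted_list_of_set S))"

lemma forces_some_var [simp]: "finite S \<Longrightarrow> forces A r V x (some_var S) \<longleftrightarrow> (\<exists>y\<in>S. x \<in> V y)"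
  by (auto simp: some_var_def)

lemma forces_mono:
  assumes "finite_poset A r" "valuation A r V" "forces A r V x \<phi>" "(x, y) \<in> r" "y \<in> A"
  shows "forces A r V y \<phi>"
  using assms(3-5)
proof (induction \<phi>)
  case (Var p)
  then show ?case using assms(2) by (auto simp: valuation_def)
next
  case (Imp \<phi> \<psi>)
  then show ?case using finite_posetD(3)[OF assms(1)] by (auto 4 3)
qed auto

text \<open>
  A Jankov formula: the variable \<open>y\<close> stands for the upset generated by \<open>y\<close>, and the four kinds
  of axioms make the set of variables forced at a point a principal downset.
\<close>

definition jankov_axioms :: "nat set \<Rightarrow> nat rel \<Rightarrow> fm set" where
  "jankov_axioms B s = {some_var B} \<union>
     (\<lambda>(y, x). Imp (Var x) (Var y)) ` (s \<inter> B \<times> B) \<union>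
     (\<lambda>(x, y). Imp (And (Var x) (Var y)) (some_var {z \<in> B. (x, z) \<in> s \<and> (y, z) \<in> s})) ` (B \<times> B) \<union>
     (\<lambda>z. Imp (Imp (Var z) (some_var {x \<in> B. (z, x) \<in> s \<and> x \<noteq> z})) (some_var {x \<in> B. (x, z) \<notin> s})) ` B"

lemma finite_jankov_axioms: "finite B \<Longrightarrow> finite (jankov_axioms B s)"
  by (simp add: jankov_axioms_def)

text \<open>The fourth kind is the interesting one. If its premise holds at w, then w is not below
  z: at z itself the variable z holds, but no variable strictly above z does. So w is the required
  variable x.\<close>

lemma jankov_axioms_valid:
  assumes B: "finite_poset B s" and q: "q \<in> B" and \<phi>: "\<phi> \<in> jankov_axioms B s"
  shows "forces B s (\<lambda>y. up_set B s y) q \<phi>"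
proof -
  note po = finite_posetD[OF B]
  have fin: "finite {x \<in> B. P x}" for P using po(1) by simp
  from \<phi> consider (total) "\<phi> = some_var B"
    | (mono) x y where "(y, x) \<in> s" "y \<in> B" "\<phi> = Imp (Var x) (Var y)"
    | (meet) x y where "\<phi> = Imp (And (Var x) (Var y)) (some_var {z \<in> B. (x, z) \<in> s \<and> (y, z) \<in> s})"
    | (imp) z where "z \<in> B"
        "\<phi> = Imp (Imp (Var z) (some_var {x \<in> B. (z, x) \<in> s \<and> x \<noteq> z})) (some_var {x \<in> B. (x, z) \<notin> s})"
    unfolding jankov_axioms_def by (elim UnE imageE) auto
  then show ?thesis
  proof cases
    case total
    then show ?thesis using q po(1,2) by (auto simp: up_set_def)
  next
    case mono
    then show ?thesis using po(3) by (auto simp: up_set_def)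
  next
    case meet
    then show ?thesis using po(2) by (auto simp: up_set_def fin)
  next
    case (imp z)
    have "\<exists>x. x \<in> B \<and> (x, z) \<notin> s \<and> (x, w) \<in> s" if w: "w \<in> B"
      and *: "\<forall>y\<in>B. (w, y) \<in> s \<longrightarrow> (z, y) \<in> s \<longrightarrow> (\<exists>x. x \<in> B \<and> (z, x) \<in> s \<and> x \<noteq> z \<and> (x, y) \<in> s)" for w
    proof -
      have "(w, z) \<notin> s"
      proof
        assume "(w, z) \<in> s"
        then obtain x where "(z, x) \<in> s" "x \<noteq> z" "(x, z) \<in> s" using * imp(1) po(2) by blast
        then show False using po(4) by blast
      qed
      then show ?thesis using w po(2) by blast
    qed
    then show ?thesis using imp by (auto simp: up_set_def fin)
  qed
qed

text \<open>The first three kinds of axioms make the set \<open>G v\<close> of variables forced at v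
  nonempty, down-closed and directed, hence a principal downset; h v is its greatest element, and
  persistence makes h monotone. The fourth kind yields the back condition: if v forces only
  variables below z, its premise must fail at v, so some u above v forces z and nothing strictly
  above z, that is, h u = z. The same argument for q at w gives t.\<close>

lemma rooted_p_morphism_if_jankov_refuted:
  assumes A: "finite_poset A r" and B: "finite_poset B s" and V: "valuation A r V" and w: "w \<in> A"
    and q: "q \<in> B" and ax: "\<And>\<phi>. \<phi> \<in> jankov_axioms B s \<Longrightarrow> forces A r V w \<phi>"
    and ref: "\<not> forces A r V w (some_var {x \<in> B. (x, q) \<notin> s})"
  shows "\<exists>t\<in>A. rooted_p_morphism A r B s t q"
proof -
  note po = finite_posetD[OF A] and poB = finite_posetD[OF B]
  have fin: "finite {x \<in> B. P x}" for P using poB(1) by simp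
  define G where "G v = {y \<in> B. v \<in> V y}" for v
  have axv: "forces A r V v \<phi>" if "v \<in> up_set A r w" "\<phi> \<in> jankov_axioms B s" for v \<phi>
    using forces_mono[OF A V ax[OF that(2)]] that(1) by (auto simp: up_set_def)
  have G_ne: "G v \<noteq> {}" if "v \<in> up_set A r w" for v
    using axv[OF that, of "some_var B"] poB(1) by (auto simp: jankov_axioms_def G_def)
  have refl: "(v, v) \<in> r" "v \<in> A" if "v \<in> up_set A r w" for v
    using that po(2) by (auto simp: up_set_def)
  have G_down: "y \<in> G v" if v: "v \<in> up_set A r w" and "x \<in> G v" "y \<in> B" "(y, x) \<in> s" for v x y
  proof -
    have "Imp (Var x) (Var y) \<in> jankov_axioms B s"
      using that unfolding jankov_axioms_def G_def by (intro UnI1 UnI2 image_eqI[of _ _ "(y, x)"]) auto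
    from axv[OF v this] show ?thesis using that refl[OF v] by (auto simp: G_def)
  qed
  have G_dir: "\<exists>z\<in>G v. (x, z) \<in> s \<and> (y, z) \<in> s"
    if v: "v \<in> up_set A r w" and "x \<in> G v" "y \<in> G v" for v x y
  proof -
    have "Imp (And (Var x) (Var y)) (some_var {z \<in> B. (x, z) \<in> s \<and> (y, z) \<in> s}) \<in> jankov_axioms B s"
      using that unfolding jankov_axioms_def G_def by (intro UnI1 UnI2 image_eqI[of _ _ "(x, y)"]) auto
    from axv[OF v this] show ?thesis using that refl[OF v] by (auto simp: G_def fin)
  qed
  have "\<exists>y\<in>G v. \<forall>x\<in>G v. (x, y) \<in> s" if v: "v \<in> up_set A r w" for v
  proof -
    obtain m where m: "m \<in> G v" "\<And>y. y \<in> G v \<Longrightarrow> (m, y) \<in> s \<Longrightarrow> y = m"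
      using ex_maximal[OF B _ G_ne[OF v]] by (auto simp: G_def)
    then have "\<forall>x\<in>G v. (x, m) \<in> s" using G_dir[OF v m(1)] by metis
    then show ?thesis using m(1) by blast
  qed
  then obtain h where h: "\<And>v. v \<in> up_set A r w \<Longrightarrow> h v \<in> G v \<and> (\<forall>x\<in>G v. (x, h v) \<in> s)" by metis
  have G_iff: "y \<in> G v \<longleftrightarrow> y \<in> B \<and> (y, h v) \<in> s" if "v \<in> up_set A r w" for v y
    using h[OF that] G_down[OF that] by (auto simp: G_def)
  have hB: "h v \<in> B" if "v \<in> up_set A r w" for v using h[OF that] by (auto simp: G_def)
  have onto: "\<exists>u\<in>up_set A r w. (v, u) \<in> r \<and> h u = z"
    if v: "v \<in> up_set A r w" and z: "z \<in> B" "\<not> forces A r V v (some_var {x \<in> B. (x, z) \<notin> s})" for v z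
  proof -
    let ?X = "Imp (Var z) (some_var {x \<in> B. (z, x) \<in> s \<and> x \<noteq> z})"
    have "Imp ?X (some_var {x \<in> B. (x, z) \<notin> s}) \<in> jankov_axioms B s"
      using z(1) unfolding jankov_axioms_def by blast
    from axv[OF v this] have "\<not> forces A r V v ?X"
      using z(2) refl[OF v] unfolding forces.simps(5)[of A r V v ?X] by blast
    then obtain u where u: "u \<in> A" "(v, u) \<in> r" "u \<in> V z" "\<forall>x\<in>{x \<in> B. (z, x) \<in> s \<and> x \<noteq> z}. u \<notin> V x"
      by (auto simp: fin)
    have u': "u \<in> up_set A r w" using u(1,2) v po(3) by (auto simp: up_set_def)
    have "(z, h u) \<in> s" using G_iff[OF u', of z] u(3) z(1) by (auto simp: G_def)
    moreover have "u \<in> V (h u)" using h[OF u'] by (auto simp: G_def)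
    ultimately have "h u = z" using u(4) hB[OF u'] by auto
    then show ?thesis using u(2) u' by blast
  qed
  have "p_morphism (up_set A r w) r B s h"
    unfolding p_morphism_def
  proof (intro conjI ballI impI funcsetI)
    show "h v \<in> B" if "v \<in> up_set A r w" for v using hB[OF that] .
    show "(h v, h u) \<in> s" if "v \<in> up_set A r w" "u \<in> up_set A r w" "(v, u) \<in> r" for v u
    proof -
      have "v \<in> V (h v)" "h v \<in> B" "u \<in> A" using h[OF that(1)] that(2) by (auto simp: G_def up_set_def)
      then have "h v \<in> G u" using V that(3) by (auto simp: G_def valuation_def)
      then show ?thesis using h[OF that(2)] by blast
    qed
    show "\<exists>u\<in>up_set A r w. (v, u) \<in> r \<and> h u = z"
      if v: "v \<in> up_set A r w" and z: "z \<in> B" "(h v, z) \<in> s" for v z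
    proof (rule onto[OF v z(1)])
      show "\<not> forces A r V v (some_var {x \<in> B. (x, z) \<notin> s})"
        using G_iff[OF v] z(2) poB(3) by (auto simp: fin G_def)
    qed
  qed
  moreover obtain t where t: "t \<in> A" "(w, t) \<in> r" "h t = q"
    using onto[OF up_set_self[OF A w] q ref] by (auto simp: up_set_def)
  ultimately have "p_morphism (up_set A r t) r B s h" using p_morphism_up_set[OF A] by blast
  then show ?thesis using t by (auto simp: rooted_p_morphism_def)
qed

text \<open>When each variable y holds on the upset of y, the point q forces exactly the variables
  below q, so it refutes the Jankov formula; containment moves the refutation to A. The points of B
  double as propositional variables, hence the type \<open>nat\<close>.\<close>

lemma logic_subset_iff:
  fixes s :: "nat rel"
  assumes A: "finite_poset A r" and B: "finite_poset B s"
  shows "logic A r \<subseteq> logic B s \<longleftrightarrow> (\<forall>q\<in>B. \<exists>t\<in>A. rooted_p_morphism A r B s t q)"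
proof
  assume sub: "logic A r \<subseteq> logic B s"
  note poB = finite_posetD[OF B]
  show "\<forall>q\<in>B. \<exists>t\<in>A. rooted_p_morphism A r B s t q"
  proof
    fix q assume q: "q \<in> B"
    obtain ax where ax: "set ax = jankov_axioms B s"
      using finite_list[OF finite_jankov_axioms[OF poB(1)]] by blast
    let ?\<phi> = "Imp (Conj ax) (some_var {x \<in> B. (x, q) \<notin> s})"
    have V: "valuation B s (\<lambda>y. up_set B s y)"
      using poB(3) by (auto simp: valuation_def up_set_def)
    have "\<not> forces B s (\<lambda>y. up_set B s y) q ?\<phi>"
      using jankov_axioms_valid[OF B q] ax q poB by (auto simp: up_set_def)
    then have "?\<phi> \<notin> logic A r" using V q sub unfolding logic_def by blast
    then obtain W x where W: "valuation A r W" "x \<in> A" "\<not> forces A r W x ?\<phi>"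
      by (auto simp: logic_def)
    then obtain w where "w \<in> A" "forces A r W w (Conj ax)"
      "\<not> forces A r W w (some_var {x \<in> B. (x, q) \<notin> s})" by auto
    then show "\<exists>t\<in>A. rooted_p_morphism A r B s t q"
      using rooted_p_morphism_if_jankov_refuted[OF A B W(1) _ q] ax by auto
  qed
next
  assume "\<forall>q\<in>B. \<exists>t\<in>A. rooted_p_morphism A r B s t q"
  then show "logic A r \<subseteq> logic B s"
    by (intro logic_subset_if_rooted_p_morphism[OF A]) simp
qed

section \<open>Bipartite matching by auction\<close>

text \<open>
  \<open>\<mu> y = Suc x\<close> means that \<open>y\<close> is matched to \<open>x\<close>, and \<open>\<mu> y = 0\<close> that it is unmatched. In each
  step, an unmatched \<open>x\<close> takes over a cheapest neighbour \<open>y\<close>, whose price \<open>p y\<close> then rises.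
\<close>

definition auction_inv ::
  "nat set \<Rightarrow> nat set \<Rightarrow> (nat \<Rightarrow> nat \<Rightarrow> bool) \<Rightarrow> nat \<Rightarrow> (nat \<Rightarrow> nat) \<Rightarrow> (nat \<Rightarrow> nat) \<Rightarrow> bool" where
  "auction_inv X Y E N \<mu> p \<longleftrightarrow>
     (\<forall>y\<in>Y. \<forall>x. \<mu> y = Suc x \<longrightarrow> x \<in> X \<and> E x y \<and> (\<forall>z\<in>Y. E x z \<longrightarrow> p y \<le> Suc (p z))) \<and>
     (\<forall>y\<in>Y. 0 < p y \<longrightarrow> 0 < \<mu> y) \<and>
     (\<forall>y\<in>Y. \<forall>z\<in>Y. \<mu> y = \<mu> z \<longrightarrow> 0 < \<mu> y \<longrightarrow> y = z) \<and> (\<forall>y\<in>Y. p y \<le> N)"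

definition bid_enabled ::
  "nat set \<Rightarrow> nat set \<Rightarrow> (nat \<Rightarrow> nat \<Rightarrow> bool) \<Rightarrow> nat \<Rightarrow> (nat \<Rightarrow> nat) \<Rightarrow> (nat \<Rightarrow> nat) \<Rightarrow> nat \<Rightarrow> nat \<Rightarrow> bool"
where
  "bid_enabled X Y E N \<mu> p x y \<longleftrightarrow> x \<in> X \<and> y \<in> Y \<and> E x y \<and> (\<forall>z\<in>Y. \<mu> z \<noteq> Suc x) \<and>
     (\<forall>z\<in>Y. E x z \<longrightarrow> p y \<le> p z) \<and> p y < N"

text \<open>Matching and prices will be read from an array that holds other data outside Y.\<close>

lemma auction_inv_cong:
  assumes "\<And>y. y \<in> Y \<Longrightarrow> \<mu> y = \<mu>' y" "\<And>y. y \<in> Y \<Longrightarrow> p y = p' y"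
  shows "auction_inv X Y E N \<mu> p \<longleftrightarrow> auction_inv X Y E N \<mu>' p'"
  using assms by (simp add: auction_inv_def)

text \<open>For the new pair, y was cheapest for x before its price rose by one. For the other
  pairs, the prices of alternatives only rise. The matching stays injective because x was unmatched
  and the former owner of y is displaced.\<close>

lemma auction_inv_bid:
  assumes "auction_inv X Y E N \<mu> p" "bid_enabled X Y E N \<mu> p x y"
  shows "auction_inv X Y E N (\<mu>(y := Suc x)) (p(y := Suc (p y)))"
proof -
  have "z \<in> X \<and> E z w \<and> (\<forall>u\<in>Y. E z u \<longrightarrow> (p(y := Suc (p y))) w \<le> Suc ((p(y := Suc (p y))) u))"
    if "w \<in> Y" "(\<mu>(y := Suc x)) w = Suc z" for w z
  proof (cases "w = y")
    case True
    then show ?thesis using assms that by (auto simp: bid_enabled_def)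
  next
    case False
    then have "z \<in> X \<and> E z w \<and> (\<forall>u\<in>Y. E z u \<longrightarrow> p w \<le> Suc (p u))"
      using assms(1) that by (simp add: auction_inv_def)
    then show ?thesis using False by (auto intro: le_SucI)
  qed
  then show ?thesis using assms unfolding auction_inv_def bid_enabled_def by auto
qed

text \<open>
  If \<open>x\<close> is stuck, then all its neighbours have price \<open>N\<close>. As there are fewer than \<open>N\<close> prices,
  some \<open>k < N\<close> is not a price. By the invariant, the neighbours of everything matched above price
  \<open>k\<close> again have prices above \<open>k\<close>; together with \<open>x\<close> this violates Hall's condition.
\<close>

lemma auction_final:
  assumes inv: "auction_inv X Y E N \<mu> p" and stuck: "\<And>x y. \<not> bid_enabled X Y E N \<mu> p x y"
    and Y: "finite Y" "card Y < N"
  shows "(\<forall>x\<in>X. \<exists>y\<in>Y. \<mu> y = Suc x) \<longleftrightarrow> (\<exists>f. inj_on f X \<and> (\<forall>x\<in>X. f x \<in> Y \<and> E x (f x)))"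
proof
  assume "\<forall>x\<in>X. \<exists>y\<in>Y. \<mu> y = Suc x"
  then obtain f where f: "\<And>x. x \<in> X \<Longrightarrow> f x \<in> Y \<and> \<mu> (f x) = Suc x" by metis
  then have "inj_on f X" by (metis inj_onI nat.inject)
  moreover have "\<forall>x\<in>X. f x \<in> Y \<and> E x (f x)" using f inv by (simp add: auction_inv_def)
  ultimately show "\<exists>f. inj_on f X \<and> (\<forall>x\<in>X. f x \<in> Y \<and> E x (f x))" by blast
next
  assume "\<exists>f. inj_on f X \<and> (\<forall>x\<in>X. f x \<in> Y \<and> E x (f x))"
  then obtain f where f: "inj_on f X" "\<And>x. x \<in> X \<Longrightarrow> f x \<in> Y \<and> E x (f x)" by auto
  show "\<forall>x\<in>X. \<exists>y\<in>Y. \<mu> y = Suc x"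
  proof (rule ccontr)
    assume "\<not> (\<forall>x\<in>X. \<exists>y\<in>Y. \<mu> y = Suc x)"
    then obtain x where x: "x \<in> X" "\<And>y. y \<in> Y \<Longrightarrow> \<mu> y \<noteq> Suc x" by blast
    have price_x: "N \<le> p y" if y: "y \<in> Y" "E x y" for y
    proof -
      obtain z where z: "z \<in> Y" "E x z" "\<And>w. w \<in> Y \<Longrightarrow> E x w \<Longrightarrow> p z \<le> p w"
        using ex_has_least_nat[of "\<lambda>y. y \<in> Y \<and> E x y" y p] y by blast
      then have "N \<le> p z" using stuck[of x z] x by (auto simp: bid_enabled_def not_less)
      then show ?thesis using z(3)[OF y] by simp
    qed
    have "card (p ` Y) < card {..<N}" using card_image_le[OF Y(1), of p] Y(2) by simp
    then have "\<not> {..<N} \<subseteq> p ` Y" using card_mono[OF finite_imageI[OF Y(1)]] by (metis not_le)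
    then obtain k where k: "k < N" "\<And>y. y \<in> Y \<Longrightarrow> p y \<noteq> k" by blast
    define Y' where "Y' = {y \<in> Y. k < p y}"
    define X' where "X' = insert x {z. \<exists>y\<in>Y'. \<mu> y = Suc z}"
    have fin: "finite Y'" using Y(1) by (simp add: Y'_def)
    have pos: "0 < \<mu> y" if "y \<in> Y'" for y using inv that by (auto simp: auction_inv_def Y'_def)
    have "{z. \<exists>y\<in>Y'. \<mu> y = Suc z} = (\<lambda>y. \<mu> y - 1) ` Y'"
    proof (intro equalityI subsetI)
      fix z assume "z \<in> {z. \<exists>y\<in>Y'. \<mu> y = Suc z}"
      then show "z \<in> (\<lambda>y. \<mu> y - 1) ` Y'" by force
    next
      fix z assume "z \<in> (\<lambda>y. \<mu> y - 1) ` Y'"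
      then show "z \<in> {z. \<exists>y\<in>Y'. \<mu> y = Suc z}" using pos by fastforce
    qed
    moreover have "inj_on (\<lambda>y. \<mu> y - 1) Y'"
    proof (rule inj_onI)
      fix y z assume yz: "y \<in> Y'" "z \<in> Y'" "\<mu> y - 1 = \<mu> z - 1"
      then have "\<mu> y = \<mu> z" using pos[of y] pos[of z] by simp
      then show "y = z" using inv yz(1,2) pos[OF yz(1)] by (simp add: auction_inv_def Y'_def)
    qed
    moreover have "x \<notin> {z. \<exists>y\<in>Y'. \<mu> y = Suc z}" using x(2) by (auto simp: Y'_def)
    ultimately have card: "card X' = Suc (card Y')" using fin by (simp add: X'_def card_image)
    have sub: "X' \<subseteq> X" using x(1) inv by (auto simp: X'_def Y'_def auction_inv_def)
    have "f z \<in> Y'" if z: "z \<in> X'" for z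
    proof -
      have fz: "f z \<in> Y" "E z (f z)" using f(2) z sub by auto
      have "k \<le> p (f z)"
      proof (cases "z = x")
        case True
        then show ?thesis using price_x[OF fz(1)] fz(2) k(1) by simp
      next
        case False
        then obtain y where "y \<in> Y'" "\<mu> y = Suc z" using z by (auto simp: X'_def)
        then have "k < p y" "p y \<le> Suc (p (f z))"
          using inv fz by (auto simp: Y'_def auction_inv_def)
        then show ?thesis by simp
      qed
      then show ?thesis using fz(1) k(2)[OF fz(1)] by (simp add: Y'_def)
    qed
    then have "card X' \<le> card Y'"
      using card_inj_on_le[OF inj_on_subset[OF f(1) sub] _ fin] by blast
    then show False using card by simp
  qed
qed

text \<open>Together with \<open>sum_price_bid\<close> this bounds the number of bids, since each
  raises the sum of prices by one.\<close>

lemma auction_price_sum: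
  assumes "auction_inv X Y E N \<mu> p" "finite Y" shows "sum p Y \<le> card Y * N"
  using sum_bounded_above[of Y p N] assms by (simp add: auction_inv_def)

lemma sum_price_bid:
  assumes "finite Y" "y \<in> Y" shows "sum (p(y := Suc (p y))) Y = Suc (sum p Y)"
  using assms by (simp add: sum.remove[OF assms] )

section \<open>Encodings and formulas as programs\<close>

lemma fold_upt_induct:
  assumes "P 0 a" "\<And>i a. i < n \<Longrightarrow> P i a \<Longrightarrow> P (Suc i) (f i a)"
  shows "P n (fold f [0..<n] a)"
  using assms by (induction n) auto

lemma length_concat_matrix: "length (concat (map (\<lambda>i. map (f i) [0..<n]) [0..<k])) = k * n"
  by (induction k) auto

lemma nth_concat_matrix:
  assumes "i < k" "j < n"
  shows "concat (map (\<lambda>i. map (f i) [0..<n]) [0..<k]) ! (i * n + j) = f i j"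
  using assms(1)
proof (induction k)
  case (Suc k)
  show ?case
  proof (cases "i = k")
    case True
    then show ?thesis using assms(2) by (simp add: nth_append length_concat_matrix)
  next
    case False
    then have i: "i < k" using Suc.prems by simp
    have "i * n + j < Suc i * n" using assms(2) by simp
    also have "\<dots> \<le> k * n" using i by (intro mult_right_mono) auto
    finally show ?thesis using Suc.IH[OF i] by (simp add: nth_append length_concat_matrix)
  qed
qed simp

lemma encode_rel_eq: "encode_rel (n, r) =
  replicate n True @ False # concat (map (\<lambda>i. map (\<lambda>j. (i, j) \<in> r) [0..<n]) [0..<n])"
  by (simp add: encode_rel_def)

lemma length_encode_rel: "length (encode_rel (n, r)) = n + 1 + n * n"
  by (simp add: encode_rel_eq length_concat_matrix)

text \<open>The prefix u and the suffix v let one statement serve both relations of a pair. Symbol k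
  of a word is at address k + 1, which turns the n + 1 symbols before the matrix into the offset n +
  2.\<close>

lemma load_encode_rel:
  assumes "w = u @ encode_rel (n, r) @ v"
  shows "i < n \<Longrightarrow> load w (length u + Suc i) = 1" "load w (length u + Suc n) = 0"
    "i < n \<Longrightarrow> j < n \<Longrightarrow> load w (length u + (n + 2) + (i * n + j)) = of_bool ((i, j) \<in> r)"
proof -
  have load: "load w (length u + Suc k) = of_bool (encode_rel (n, r) ! k)" if "k < n + 1 + n * n" for k
    using that by (simp add: load_def assms nth_append length_encode_rel)
  show "load w (length u + Suc i) = 1" if "i < n"
    using load[of i] that by (simp add: encode_rel_eq nth_append)
  show "load w (length u + Suc n) = 0"
    using load[of n] by (simp add: encode_rel_eq nth_append)
  show "load w (length u + (n + 2) + (i * n + j)) = of_bool ((i, j) \<in> r)" if ij: "i < n" "j < n"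
  proof -
    have "i * n + j < Suc i * n" using ij(2) by simp
    also have "\<dots> \<le> n * n" using ij(1) by (intro mult_right_mono) auto
    finally show ?thesis
      using load[of "n + 1 + (i * n + j)"] nth_concat_matrix[OF ij, of "\<lambda>i j. (i, j) \<in> r"]
      by (simp add: encode_rel_eq nth_append add.assoc)
  qed
qed

section \<open>Bounded first-order conditions as terms\<close>

definition tr :: "mem \<Rightarrow> tm \<Rightarrow> (nat \<Rightarrow> nat) \<Rightarrow> (nat \<Rightarrow> nat) \<Rightarrow> bool" where
  "tr I t \<sigma> a \<longleftrightarrow> tval I t \<sigma> a \<noteq> 0"

text \<open>With nonzero as true, truncated subtraction gives negation and strict order, addition is
  disjunction, and \<open>Sum\<close> is a bounded existential quantifier.\<close>

definition "NOT t = Sub (Num 1) t"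
definition "AND t u = Ite t u (Num 0)"
definition "OR t u = Add t u"
definition "IMP t u = OR (NOT t) u"
definition "LT t u = Sub u t"
definition "LE t u = NOT (Sub t u)"
definition "EQ t u = AND (LE t u) (LE u t)"
definition "EXISTS x t = Sum x t"
definition "FORALL x t = NOT (EXISTS x (NOT t))"

lemma tr_simps [simp]:
  "tr I (NOT t) \<sigma> a \<longleftrightarrow> \<not> tr I t \<sigma> a"
  "tr I (AND t u) \<sigma> a \<longleftrightarrow> tr I t \<sigma> a \<and> tr I u \<sigma> a"
  "tr I (OR t u) \<sigma> a \<longleftrightarrow> tr I t \<sigma> a \<or> tr I u \<sigma> a"
  "tr I (IMP t u) \<sigma> a \<longleftrightarrow> (tr I t \<sigma> a \<longrightarrow> tr I u \<sigma> a)"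
  "tr I (LT t u) \<sigma> a \<longleftrightarrow> tval I t \<sigma> a < tval I u \<sigma> a"
  "tr I (LE t u) \<sigma> a \<longleftrightarrow> tval I t \<sigma> a \<le> tval I u \<sigma> a"
  "tr I (EQ t u) \<sigma> a \<longleftrightarrow> tval I t \<sigma> a = tval I u \<sigma> a"
  "tr I (EXISTS x t) \<sigma> a \<longleftrightarrow> (\<exists>i<I 0. tr I t (\<sigma>(x := i)) a)"
  "tr I (Inp t) \<sigma> a \<longleftrightarrow> I (tval I t \<sigma> a) \<noteq> 0"
  "tr I (Arr t) \<sigma> a \<longleftrightarrow> a (tval I t \<sigma> a) \<noteq> 0"
  by (auto simp: tr_def NOT_def AND_def OR_def IMP_def LT_def LE_def EQ_def EXISTS_def)

lemma tr_FORALL [simp]: "tr I (FORALL x t) \<sigma> a \<longleftrightarrow> (\<forall>i<I 0. tr I t (\<sigma>(x := i)) a)"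
  by (simp add: FORALL_def)

lemma tval_Ite [simp]: "tval I (Ite t u v) \<sigma> a = (if tr I t \<sigma> a then tval I u \<sigma> a else tval I v \<sigma> a)"
  by (simp add: tr_def)

lemma sem_When [simp]: "sem I (When t c) \<sigma> a = (if tr I t \<sigma> a then sem I c \<sigma> a else a)"
  by (simp add: tr_def)

declare tval.simps(7) [simp del] sem.simps(3) [simp del]

text \<open>Variables \<open>20\<close>, \<open>21\<close> and \<open>22\<close> are reserved for the next two terms.\<close>

definition "MUL t u = Sum 20 (Ite (LT (Loc 20) t) u (Num 0))"

definition "ONES t = Sum 21 (Ite (FORALL 22 (IMP (LE (Loc 22) (Loc 21)) (Inp (Add t (Add (Loc 22) (Num 1))))))
  (Num 1) (Num 0))"

lemma sum_threshold:
  fixes c :: nat assumes "k \<le> n" shows "(\<Sum>i<n. if i < k then c else 0) = k * c"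
proof -
  have "{..<n} \<inter> {i. i < k} = {..<k}" using assms by auto
  then show ?thesis by (simp add: sum.If_cases)
qed

text \<open>u is added once for each i below t, so the first factor must not exceed the loop bound.
  The first two hypotheses express that neither factor depends on variable 20.\<close>

lemma tval_MUL:
  assumes "\<And>i. tval I t (\<sigma>(20 := i)) a = k" "\<And>i. tval I u (\<sigma>(20 := i)) a = l" "k \<le> I 0"
  shows "tval I (MUL t u) \<sigma> a = k * l"
  using sum_threshold[OF assms(3), of l] by (simp add: MUL_def assms(1,2) cong: if_cong)

text \<open>Reads a unary number: i contributes iff the cells l + 1 to l + i + 1 are all nonzero, so
  counting stops at the delimiter even if ones follow later.\<close>

lemma tval_ONES:
  assumes "\<And>\<sigma>. tval I t \<sigma> a = l" "\<And>i. i < k \<Longrightarrow> I (l + Suc i) \<noteq> 0" "I (l + Suc k) = 0" "k < I 0"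
  shows "tval I (ONES t) \<sigma> a = k"
proof -
  have "(\<forall>j<I 0. j \<le> i \<longrightarrow> I (l + Suc j) \<noteq> 0) \<longleftrightarrow> i < k" if "i < I 0" for i
    using assms(2-4) that by (metis le_less_trans less_imp_le_nat not_le)
  then have "tval I (ONES t) \<sigma> a = (\<Sum>i<I 0. if i < k then 1 else 0)"
    by (simp add: ONES_def assms(1) cong: if_cong)
  then show ?thesis using sum_threshold[of k "I 0" 1] assms(4) by simp
qed

section \<open>The decision procedure\<close>

definition "LEN = Inp (Num 0)"

definition "REL off N x y = Inp (Add (Add off (Add N (Num 2))) (Add (MUL (Loc x) N) (Loc y)))"

text \<open>The variable \<open>8\<close> is reserved for the next term.\<close>

definition "COVER off N x y = AND (LT (Loc x) N) (AND (LT (Loc y) N) (AND (REL off N x y)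
  (AND (NOT (EQ (Loc y) (Loc x))) (FORALL 8 (IMP (LT (Loc 8) N) (IMP (REL off N x 8)
    (IMP (REL off N 8 y) (OR (EQ (Loc 8) (Loc x)) (EQ (Loc 8) (Loc y))))))))))"

text \<open>Both sizes are recomputed from their unary prefixes at each use; \<open>OFFQ\<close> is
  the length of the encoding of the tree.\<close>

definition "NT = ONES (Num 0)"
definition "OFFQ = Add (Add NT (Num 1)) (MUL NT NT)"
definition "NQ = ONES OFFQ"

definition "REL_T = REL (Num 0) NT"
definition "REL_Q = REL OFFQ NQ"
definition "CHILD = COVER (Num 0) NT"
definition "COVER_Q = COVER OFFQ NQ"

text \<open>
  The array holds the matching at \<open>{..<L}\<close>, the prices at \<open>{L..<2 * L}\<close>, and from \<open>2 * L\<close> on the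
  table of the pairs \<open>(t, q)\<close> for which a p-morphism has been found, where \<open>L\<close> is the input length.
  The variables \<open>1\<close> and \<open>2\<close> are \<open>t\<close> and \<open>q\<close>.
\<close>

definition "PRICE y = Add LEN (Loc y)"
definition "ENTRY t q = Add (Add LEN LEN) (Add (MUL (Loc t) LEN) (Loc q))"

text \<open>The bidders are the covers of q (variable 4), the items are the children of t (variables
  5 and 6), and the edges are the table entries found so far. The price cap n + 1 exceeds the number
  of children.\<close>

definition "BID_ENABLED = AND (COVER_Q 2 4) (AND (CHILD 1 5) (AND (Arr (ENTRY 5 4))
  (AND (FORALL 6 (IMP (CHILD 1 6) (NOT (EQ (Arr (Loc 6)) (Add (Loc 4) (Num 1))))))
    (AND (FORALL 6 (IMP (CHILD 1 6) (IMP (Arr (ENTRY 6 4)) (LE (Arr (PRICE 5)) (Arr (PRICE 6))))))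
      (LT (Arr (PRICE 5)) (Add NT (Num 1)))))))"

definition "BID = Then (Write (Loc 5) (Add (Loc 4) (Num 1))) (Write (PRICE 5) (Add (Arr (PRICE 5)) (Num 1)))"

definition "CLEAR = Loop 4 (Then (Write (Loc 4) (Num 0)) (Write (PRICE 4) (Num 0)))"

text \<open>Each pass over all pairs makes a bid unless the auction is stuck. The sum of prices
  stays below L, so L passes suffice.\<close>

definition "AUCTION = Then CLEAR (Loop 3 (Loop 4 (Loop 5 (When BID_ENABLED BID))))"

definition "FOUND = OR (EXISTS 5 (AND (CHILD 1 5) (Arr (ENTRY 5 2))))
  (FORALL 4 (IMP (COVER_Q 2 4) (EXISTS 5 (AND (CHILD 1 5) (EQ (Arr (Loc 5)) (Add (Loc 4) (Num 1)))))))"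

definition "UPDATE = When (AND (LT (Loc 1) NT) (LT (Loc 2) NQ))
  (Then AUCTION (When FOUND (Write (ENTRY 1 2) (Num 1))))"

text \<open>Repeating the rule for all pairs avoids ordering the tree from the leaves down: after k
  rounds every t whose upset has at most k elements is settled.\<close>

definition "FILL_TABLE = Loop 0 (Loop 1 (Loop 2 UPDATE))"

definition "SPMORPH = EXISTS 1 (AND (LT (Loc 1) NT)
  (AND (FORALL 5 (IMP (LT (Loc 5) NT) (REL_T 1 5)))
    (EXISTS 2 (AND (LT (Loc 2) NQ)
      (AND (FORALL 4 (IMP (LT (Loc 4) NQ) (REL_Q 2 4))) (Arr (ENTRY 1 2)))))))"

definition "LOGCONTAIN = FORALL 2 (IMP (LT (Loc 2) NQ) (EXISTS 1 (AND (LT (Loc 1) NT) (Arr (ENTRY 1 2)))))"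

definition "DECIDE = Then FILL_TABLE (Then (Write (Num 0) (Ite SPMORPH (Num 1) (Num 0)))
  (Write (Num 1) (Ite LOGCONTAIN (Num 1) (Num 0))))"

section \<open>Meaning of the terms on an encoded instance\<close>

lemma tval_LEN [simp]: "tval I LEN \<sigma> a = I 0"
  by (simp add: LEN_def)

lemma tval_PRICE [simp]: "tval I (PRICE y) \<sigma> a = I 0 + \<sigma> y"
  by (simp add: PRICE_def)

lemma tval_ENTRY:
  assumes "\<sigma> t < I 0" "t \<noteq> 20"
  shows "tval I (ENTRY t q) \<sigma> a = 2 * I 0 + (\<sigma> t * I 0 + \<sigma> q)"
  using assms tval_MUL[of I "Loc t" \<sigma> a "\<sigma> t" LEN "I 0"] by (simp add: ENTRY_def)

lemma tr_REL:
  assumes "\<And>\<sigma>. tval I off \<sigma> a = k" "\<And>\<sigma>. tval I N \<sigma> a = n" "x \<noteq> 20" "n \<le> I 0"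
    and "\<And>i j. i < n \<Longrightarrow> j < n \<Longrightarrow> I (k + (n + 2) + (i * n + j)) = of_bool ((i, j) \<in> r)"
    and "\<sigma> x < n" "\<sigma> y < n"
  shows "tr I (REL off N x y) \<sigma> a \<longleftrightarrow> (\<sigma> x, \<sigma> y) \<in> r"
  using assms tval_MUL[of I "Loc x" \<sigma> a "\<sigma> x" N n] by (simp add: REL_def)

lemma tr_COVER:
  assumes "\<And>\<sigma>. tval I off \<sigma> a = k" "\<And>\<sigma>. tval I N \<sigma> a = n" "x \<notin> {8, 20}" "y \<noteq> 8" "n \<le> I 0"
    and "\<And>i j. i < n \<Longrightarrow> j < n \<Longrightarrow> I (k + (n + 2) + (i * n + j)) = of_bool ((i, j) \<in> r)"
  shows "tr I (COVER off N x y) \<sigma> a \<longleftrightarrow> \<sigma> x < n \<and> \<sigma> y \<in> covers {..<n} r (\<sigma> x)"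
proof -
  note rel = tr_REL[OF assms(1,2) _ assms(5,6)]
  have "tr I (COVER off N x y) \<sigma> a \<longleftrightarrow> \<sigma> x < n \<and> \<sigma> y < n \<and> (\<sigma> x, \<sigma> y) \<in> r \<and> \<sigma> y \<noteq> \<sigma> x \<and>
      (\<forall>z<I 0. z < n \<longrightarrow> (\<sigma> x, z) \<in> r \<longrightarrow> (z, \<sigma> y) \<in> r \<longrightarrow> z = \<sigma> x \<or> z = \<sigma> y)"
    using assms(2-4) by (auto simp: COVER_def rel)
  moreover have "(\<forall>z<I 0. z < n \<longrightarrow> P z) \<longleftrightarrow> (\<forall>z\<in>{..<n}. P z)" for P
    using assms(5) by auto
  ultimately show ?thesis by (auto simp: covers_def)
qed

locale instance_pair =
  fixes n m :: nat and r s :: "nat rel"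
  assumes tree: "finite_tree {..<n} r" and poset: "finite_poset {..<m} s"
begin

definition I :: mem where "I = load (encode_pair ((n, r), (m, s)))"

abbreviation "L \<equiv> I 0"

lemma len: "L = (n + 1 + n * n) + (m + 1 + m * m)"
  by (simp add: I_def load_def encode_pair_def length_encode_rel)

text \<open>The third bound is for the auction: at most n children, each with price at most n +
  1.\<close>

lemma bounds: "n < L" "m < L" "n * (n + 1) < L"
  by (simp_all add: len)

lemma I_tree:
  "i < n \<Longrightarrow> I (Suc i) = 1" "I (Suc n) = 0"
  "i < n \<Longrightarrow> j < n \<Longrightarrow> I (0 + (n + 2) + (i * n + j)) = of_bool ((i, j) \<in> r)"
  using load_encode_rel[of "encode_pair ((n, r), (m, s))" "[]" n r "encode_rel (m, s)"]
  by (simp_all add: I_def encode_pair_def)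

lemma I_poset:
  "i < m \<Longrightarrow> I (n + 1 + n * n + Suc i) = 1" "I (n + 1 + n * n + Suc m) = 0"
  "i < m \<Longrightarrow> j < m \<Longrightarrow> I (n + 1 + n * n + (m + 2) + (i * m + j)) = of_bool ((i, j) \<in> s)"
  using load_encode_rel[of "encode_pair ((n, r), (m, s))" "encode_rel (n, r)" m s "[]"]
  by (simp_all only: I_def encode_pair_def length_encode_rel prod.case append_Nil2)

lemma tval_NT [simp]: "tval I NT \<sigma> a = n"
  unfolding NT_def by (rule tval_ONES[where l = 0]) (use I_tree bounds in auto)

lemma tval_OFFQ [simp]: "tval I OFFQ \<sigma> a = n + 1 + n * n"
  using bounds(1) tval_MUL[of I NT \<sigma> a n NT n] by (simp add: OFFQ_def)

lemma tval_NQ [simp]: "tval I NQ \<sigma> a = m"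
  unfolding NQ_def by (rule tval_ONES[where l = "n + 1 + n * n"]) (use I_poset bounds in \<open>auto simp del: add_Suc_right\<close>)

lemma tr_REL_T: "\<sigma> x < n \<Longrightarrow> \<sigma> y < n \<Longrightarrow> x \<noteq> 20 \<Longrightarrow> tr I (REL_T x y) \<sigma> a \<longleftrightarrow> (\<sigma> x, \<sigma> y) \<in> r"
  unfolding REL_T_def by (rule tr_REL[where k = 0 and n = n]) (use bounds I_tree(3) in auto)

lemma tr_REL_Q: "\<sigma> x < m \<Longrightarrow> \<sigma> y < m \<Longrightarrow> x \<noteq> 20 \<Longrightarrow> tr I (REL_Q x y) \<sigma> a \<longleftrightarrow> (\<sigma> x, \<sigma> y) \<in> s"
  unfolding REL_Q_def
  by (rule tr_REL[where k = "n + 1 + n * n" and n = m]) (use bounds I_poset(3) in auto)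

lemma tr_CHILD:
  "x \<notin> {8, 20} \<Longrightarrow> y \<noteq> 8 \<Longrightarrow> tr I (CHILD x y) \<sigma> a \<longleftrightarrow> \<sigma> x < n \<and> \<sigma> y \<in> covers {..<n} r (\<sigma> x)"
  unfolding CHILD_def by (rule tr_COVER[where k = 0]) (use bounds I_tree(3) in auto)

lemma tr_COVER_Q:
  "x \<notin> {8, 20} \<Longrightarrow> y \<noteq> 8 \<Longrightarrow> tr I (COVER_Q x y) \<sigma> a \<longleftrightarrow> \<sigma> x < m \<and> \<sigma> y \<in> covers {..<m} s (\<sigma> x)"
  unfolding COVER_Q_def
  by (rule tr_COVER[where k = "n + 1 + n * n"]) (use bounds I_poset(3) in auto)

abbreviation "children \<equiv> covers {..<n} r"
abbreviation "succs \<equiv> covers {..<m} s"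
abbreviation "entry t q \<equiv> 2 * L + (t * L + q)"
abbreviation "found a t q \<equiv> a (entry t q) \<noteq> 0"
abbreviation "achievable \<equiv> rooted_p_morphism {..<n} r {..<m} s"

lemma children_less: "c \<in> children t \<Longrightarrow> c < n" and succs_less: "x \<in> succs q \<Longrightarrow> x < m"
  by (auto dest: coversD)

lemma entry_eq_iff:
  assumes "q < L" "q' < L" shows "entry t q = entry t' q' \<longleftrightarrow> t = t' \<and> q = q'"
proof
  assume "entry t q = entry t' q'"
  then have eq: "t * L + q = t' * L + q'" by simp
  have "t = (t * L + q) div L" "t' = (t' * L + q') div L" using assms by simp_all
  then have "t = t'" using eq by simp
  then show "t = t' \<and> q = q'" using eq by simp
qed simp

section \<open>The auction for one pair, run on the array\<close>

abbreviation "enabled t q a \<equiv> bid_enabled (succs q) (children t) (\<lambda>x y. found a y x) (n + 1) a (\<lambda>y. a (L + y))"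

abbreviation "auction_ok t q a \<equiv> auction_inv (succs q) (children t) (\<lambda>x y. found a y x) (n + 1) a (\<lambda>y. a (L + y))"

abbreviation "price_sum t a \<equiv> \<Sum>y\<in>children t. a (L + y)"

abbreviation "bid x y a \<equiv> a(y := Suc x, L + y := Suc (a (L + y)))"

lemma tr_BID_ENABLED:
  assumes "\<sigma> 1 = t" "\<sigma> 2 = q" "\<sigma> 4 = x" "\<sigma> 5 = y" "t < n" "q < m"
  shows "tr I BID_ENABLED \<sigma> a \<longleftrightarrow> enabled t q a x y"
proof -
  have "z < L" if "z \<in> children t" for z using children_less[OF that] bounds(1) by simp
  then show ?thesis using assms
    by (auto simp: BID_ENABLED_def bid_enabled_def tr_CHILD tr_COVER_Q tval_ENTRY)
qed

lemma sem_BID: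
  assumes "\<sigma> 4 = x" "\<sigma> 5 = y" "y < L"
  shows "sem I BID \<sigma> a = bid x y a"
  using assms by (simp add: BID_def)

abbreviation "same_table a b \<equiv> \<forall>i\<ge>2 * L. b i = a i"

text \<open>Children are numbers below L, so the blocks for matching, prices and table do not
  interfere: a bid leaves the table alone, and with it the edges of the matching problem.\<close>

lemma bid_step:
  assumes "auction_ok t q a" "enabled t q a x y"
  shows "auction_ok t q (bid x y a)" "price_sum t (bid x y a) = Suc (price_sum t a)"
    "same_table a (bid x y a)"
proof -
  have y: "y \<in> children t" "y < L"
    using assms(2) children_less[of y t] bounds(1) by (auto simp: bid_enabled_def)
  show tab: "same_table a (bid x y a)" using y(2) by auto
  have p: "(\<lambda>z. bid x y a (L + z)) = (\<lambda>z. a (L + z))(y := Suc (a (L + y)))"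
    using y(2) by (auto simp: fun_eq_iff)
  have \<mu>: "bid x y a z = (a(y := Suc x)) z" if "z \<in> children t" for z
    using children_less[OF that] bounds(1) by simp
  have found: "bid x y a (entry z w) = a (entry z w)" for z w by (rule tab[rule_format]) simp
  show "auction_ok t q (bid x y a)"
    unfolding found p by (rule iffD2[OF auction_inv_cong[OF \<mu> refl] auction_inv_bid[OF assms]])
  have fin: "finite (children t)" by (rule finite_subset[of _ "{..<n}"]) (auto dest: children_less)
  show "price_sum t (bid x y a) = Suc (price_sum t a)"
    unfolding fun_cong[OF p] by (rule sum_price_bid[OF fin y(1)])
qed

definition "sweep t q = fold (\<lambda>x. fold (\<lambda>y a. if enabled t q a x y then bid x y a else a) [0..<L]) [0..<L]"

lemma sem_sweep:
  assumes "\<sigma> 1 = t" "\<sigma> 2 = q" "t < n" "q < m"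
  shows "sem I (Loop 4 (Loop 5 (When BID_ENABLED BID))) \<sigma> a = sweep t q a"
  unfolding sweep_def sem.simps(4)
  using assms by (intro fold_cong refl ext) (auto simp: tr_BID_ENABLED sem_BID)

lemma sweep_progress:
  assumes ok: "auction_ok t q a"
  defines "b \<equiv> sweep t q a"
  shows "auction_ok t q b" "same_table a b"
    "(b = a \<and> (\<forall>x y. \<not> enabled t q a x y)) \<or>
     ((\<exists>x y. enabled t q a x y) \<and> price_sum t a < price_sum t b)"
proof -
  define P where "P S b \<longleftrightarrow> auction_ok t q b \<and> same_table a b \<and>
    ((b = a \<and> (\<forall>x y. (x, y) \<in> S \<longrightarrow> \<not> enabled t q a x y)) \<or>
     ((\<exists>x y. enabled t q a x y) \<and> price_sum t a < price_sum t b))" for S b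
  have step: "P (insert (x, y) S) (if enabled t q b x y then bid x y b else b)" if "P S b" for S b x y
  proof (cases "enabled t q b x y")
    case True
    have ok: "auction_ok t q b" and "same_table a b" using that by (auto simp: P_def)
    moreover have "price_sum t a \<le> price_sum t b" "\<exists>x y. enabled t q a x y"
      using that True by (auto simp: P_def)
    ultimately show ?thesis
      unfolding P_def using bid_step[OF ok True] True by simp
  next
    case False
    then show ?thesis using that by (auto simp: P_def)
  qed
  have "P ({..<L} \<times> {..<L}) b"
    unfolding b_def sweep_def
  proof (rule fold_upt_induct[where P = "\<lambda>i. P ({..<i} \<times> {..<L})"])
    show "P ({..<0} \<times> {..<L}) a" using ok by (simp add: P_def)
    fix i b assume b: "P ({..<i} \<times> {..<L}) b"
    have "P ({..<i} \<times> {..<L} \<union> {i} \<times> {..<L})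
      (fold (\<lambda>y a. if enabled t q a i y then bid i y a else a) [0..<L] b)"
    proof (rule fold_upt_induct[where P = "\<lambda>j. P ({..<i} \<times> {..<L} \<union> {i} \<times> {..<j})"])
      fix j c assume "P ({..<i} \<times> {..<L} \<union> {i} \<times> {..<j}) c"
      from step[OF this, of i j]
      show "P ({..<i} \<times> {..<L} \<union> {i} \<times> {..<Suc j}) (if enabled t q c i j then bid i j c else c)"
        by (simp add: lessThan_Suc insert_commute)
    qed (use b in simp)
    moreover have "{..<i} \<times> {..<L} \<union> {i} \<times> {..<L} = {..<Suc i} \<times> {..<L}" by auto
    ultimately show "P ({..<Suc i} \<times> {..<L})
      (fold (\<lambda>y a. if enabled t q a i y then bid i y a else a) [0..<L] b)" by simp
  qed
  moreover have "(x, y) \<in> {..<L} \<times> {..<L}" if "enabled t q a x y" for x y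
    using that children_less[of y t] succs_less[of x q] bounds by (auto simp: bid_enabled_def)
  ultimately show "auction_ok t q b" "same_table a b"
    "(b = a \<and> (\<forall>x y. \<not> enabled t q a x y)) \<or>
     ((\<exists>x y. enabled t q a x y) \<and> price_sum t a < price_sum t b)"
    unfolding P_def by blast+
qed

lemma sem_CLEAR:
  "(\<forall>c<L. sem I CLEAR \<sigma> a c = 0 \<and> sem I CLEAR \<sigma> a (L + c) = 0) \<and> same_table a (sem I CLEAR \<sigma> a)"
  unfolding CLEAR_def sem.simps(4)
  by (rule fold_upt_induct[where P = "\<lambda>i b. (\<forall>c<i. b c = 0 \<and> b (L + c) = 0) \<and> same_table a b"])
    (auto simp: less_Suc_eq)

lemma price_sum_less: "auction_ok t q a \<Longrightarrow> price_sum t a < L"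
proof -
  assume ok: "auction_ok t q a"
  have sub: "children t \<subseteq> {..<n}" by (auto dest: children_less)
  have "price_sum t a \<le> card (children t) * (n + 1)"
    using auction_price_sum[OF ok] finite_subset[OF sub] by simp
  also have "\<dots> \<le> n * (n + 1)" using card_mono[OF _ sub] by (intro mult_right_mono) auto
  also have "\<dots> < L" by (rule bounds(3))
  finally show ?thesis .
qed

lemma sem_AUCTION:
  fixes a b :: "nat \<Rightarrow> nat"
  assumes "\<sigma> 1 = t" "\<sigma> 2 = q" "t < n" "q < m"
  defines "b \<equiv> sem I AUCTION \<sigma> a"
  shows "auction_ok t q b" "\<not> enabled t q b x y" "same_table a b"
proof -
  \<comment> \<open>After k passes the auction is stuck or the sum of prices has reached k; k = L is
    excluded by \<open>price_sum_less\<close>.\<close>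
  let ?P = "\<lambda>k b. auction_ok t q b \<and> same_table a b \<and> ((\<forall>x y. \<not> enabled t q b x y) \<or> k \<le> price_sum t b)"
  have b: "b = fold (\<lambda>i. sweep t q) [0..<L] (sem I CLEAR \<sigma> a)"
    unfolding b_def AUCTION_def sem.simps(2) sem.simps(4)[of I 3]
    using assms(1-4) by (intro fold_cong refl ext sem_sweep) auto
  have "?P L b"
    unfolding b
  proof (rule fold_upt_induct[where P = ?P])
    have "c < L" if "c \<in> children t" for c using children_less[OF that] bounds(1) by simp
    then show "?P 0 (sem I CLEAR \<sigma> a)" using sem_CLEAR[of \<sigma> a] by (simp add: auction_inv_def)
  next
    fix k c assume c: "?P k c"
    then have ok: "auction_ok t q c" by blast
    show "?P (Suc k) (sweep t q c)"
      using c sweep_progress[OF ok] by (auto simp: not_le)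
  qed
  then show "auction_ok t q b" "\<not> enabled t q b x y" "same_table a b"
    using price_sum_less[of q t b] by auto
qed

section \<open>Filling the table\<close>

definition rule_applies :: "(nat \<Rightarrow> nat) \<Rightarrow> nat \<Rightarrow> nat \<Rightarrow> bool" where
  "rule_applies a t q \<longleftrightarrow> (\<exists>c\<in>children t. found a c q) \<or>
    (\<exists>f. inj_on f (succs q) \<and> (\<forall>x\<in>succs q. f x \<in> children t \<and> found a (f x) x))"

lemma tr_FOUND:
  assumes "\<sigma> 1 = t" "\<sigma> 2 = q" "t < n" "q < m"
    and ok: "auction_ok t q a" and stuck: "\<And>x y. \<not> enabled t q a x y"
  shows "tr I FOUND \<sigma> a \<longleftrightarrow> rule_applies a t q"
proof -
  have sub: "children t \<subseteq> {..<n}" by (auto dest: children_less)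
  have "card (children t) < n + 1" using card_mono[OF _ sub] by simp
  note final = auction_final[OF ok stuck finite_subset[OF sub] this]
  have less: "c < L" if "c \<in> children t" for c using children_less[OF that] bounds(1) by simp
  have less': "x < L" if "x \<in> succs q" for x using succs_less[OF that] bounds(2) by simp
  have "tr I FOUND \<sigma> a \<longleftrightarrow> (\<exists>c<L. c \<in> children t \<and> found a c q) \<or>
      (\<forall>x<L. x \<in> succs q \<longrightarrow> (\<exists>y<L. y \<in> children t \<and> a y = Suc x))"
    using assms(1-4) by (simp add: FOUND_def tr_CHILD tr_COVER_Q tval_ENTRY cong: conj_cong)
  also have "\<dots> \<longleftrightarrow> (\<exists>c\<in>children t. found a c q) \<or> (\<forall>x\<in>succs q. \<exists>y\<in>children t. a y = Suc x)"
    using less less' by blast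
  finally show ?thesis using final by (simp add: rule_applies_def)
qed

lemma sem_UPDATE:
  assumes "\<sigma> 1 = t" "\<sigma> 2 = q" "2 * L \<le> i"
  shows "sem I UPDATE \<sigma> a i = (if t < n \<and> q < m \<and> i = entry t q \<and> rule_applies a t q then 1 else a i)"
proof (cases "t < n \<and> q < m")
  case True
  note auction = sem_AUCTION[OF assms(1,2) conjunct1[OF True] conjunct2[OF True], of a]
  \<comment> \<open>The auction does not touch the table, so the rule may be judged on the array
    before it.\<close>
  have "rule_applies (sem I AUCTION \<sigma> a) t q = rule_applies a t q"
    using auction(3) by (simp add: rule_applies_def)
  then show ?thesis
    using True assms auction(3) tr_FOUND[OF assms(1,2) _ _ auction(1,2)] bounds(1)
    by (simp add: UPDATE_def tval_ENTRY)
next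
  case False
  then show ?thesis using assms by (auto simp: UPDATE_def)
qed

lemma achievable_rule:
  assumes "t < n" "q < m"
  shows "achievable t q \<longleftrightarrow> (\<exists>c\<in>children t. achievable c q) \<or>
    (\<exists>f. inj_on f (succs q) \<and> (\<forall>x\<in>succs q. f x \<in> children t \<and> achievable (f x) x))"
  using rooted_p_morphism_rec[OF tree poset] assms by simp

definition sound :: "(nat \<Rightarrow> nat) \<Rightarrow> bool" where
  "sound a \<longleftrightarrow> (\<forall>t<n. \<forall>q<m. found a t q \<longrightarrow> achievable t q)"

text \<open>The size of the upset drops from t to its children, so it bounds the number of rounds
  after which t is settled.\<close>

definition complete :: "nat \<Rightarrow> (nat \<Rightarrow> nat) \<Rightarrow> bool" where
  "complete k a \<longleftrightarrow> (\<forall>t<n. \<forall>q<m. card (up_set {..<n} r t) \<le> k \<longrightarrow> achievable t q \<longrightarrow> found a t q)"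

lemma card_up_set_child: "t < n \<Longrightarrow> c \<in> children t \<Longrightarrow> card (up_set {..<n} r c) < card (up_set {..<n} r t)"
proof -
  note po = finite_treeD(1)[OF tree]
  assume t: "t < n" and c: "c \<in> children t"
  have "t \<notin> up_set {..<n} r c"
    using coversD[OF c] finite_posetD(4)[OF po] by (auto simp: up_set_def)
  then have "up_set {..<n} r c \<subset> up_set {..<n} r t"
    using up_set_mono[OF po coversD(2)[OF c]] up_set_self[OF po, of t] t by blast
  then show ?thesis by (intro psubset_card_mono) (auto simp: up_set_def)
qed

lemma sound_rule_applies:
  assumes "sound a" "t < n" "q < m" "rule_applies a t q" shows "achievable t q"
proof -
  have "achievable c x" if "c \<in> children t" "x < m" "found a c x" for c x
    using assms(1) that children_less[OF that(1)] by (simp add: sound_def)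
  then show ?thesis
    using assms(3,4) succs_less unfolding achievable_rule[OF assms(2,3)] rule_applies_def by metis
qed

lemma complete_rule_applies:
  assumes "complete k a" "t < n" "q < m" "card (up_set {..<n} r t) \<le> Suc k" "achievable t q"
  shows "rule_applies a t q"
proof -
  have "found a c x" if "c \<in> children t" "x < m" "achievable c x" for c x
    using assms(1,4) that children_less[OF that(1)] card_up_set_child[OF assms(2) that(1)]
    by (simp add: complete_def)
  then show ?thesis
    using assms(3,5) succs_less unfolding achievable_rule[OF assms(2,3)] rule_applies_def by metis
qed

lemma found_UPDATE:
  assumes "\<sigma> 1 = t" "\<sigma> 2 = q" "q < L" "q' < m"
  shows "found (sem I UPDATE \<sigma> a) t' q' \<longleftrightarrow>
    found a t' q' \<or> (t' = t \<and> q' = q \<and> t < n \<and> q < m \<and> rule_applies a t q)"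
proof -
  have "q' < L" using assms(4) bounds(2) by simp
  from sem_UPDATE[OF assms(1,2), of "entry t' q'" a] entry_eq_iff[OF this assms(3), of t' t]
  show ?thesis by auto
qed

lemma sem_FILL_TABLE:
  assumes "\<And>i. a i = 0" "t < n" "q < m"
  shows "found (sem I FILL_TABLE \<sigma> a) t q \<longleftrightarrow> achievable t q"
proof -
  note po = finite_treeD(1)[OF tree]
  \<comment> \<open>The table is updated in place: S is the set of pairs already treated in the
    current round, for which the next level Suc k is settled. Entries are never erased, so this
    persists.\<close>
  define P where "P k S b \<longleftrightarrow> sound b \<and> complete k b \<and> (\<forall>t<n. \<forall>q<m. (t, q) \<in> S \<longrightarrow>
    card (up_set {..<n} r t) \<le> Suc k \<longrightarrow> achievable t q \<longrightarrow> found b t q)" for k S b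
  have step: "P k (insert (t, q) S) (sem I UPDATE \<sigma> b)"
    if "P k S b" "\<sigma> 1 = t" "\<sigma> 2 = q" "q < L" for k S b t q \<sigma>
  proof -
    let ?c = "sem I UPDATE \<sigma> b"
    have found: "found ?c t' q' \<longleftrightarrow> found b t' q' \<or> (t' = t \<and> q' = q \<and> t < n \<and> q < m \<and> rule_applies b t q)"
      if "q' < m" for t' q'
      by (rule found_UPDATE) fact+
    have b: "sound b" "complete k b" "\<forall>t<n. \<forall>q<m. (t, q) \<in> S \<longrightarrow>
        card (up_set {..<n} r t) \<le> Suc k \<longrightarrow> achievable t q \<longrightarrow> found b t q"
      using that(1) by (simp_all add: P_def)
    have "sound ?c"
      unfolding sound_def
    proof (intro allI impI)
      fix t' q' assume "t' < n" "q' < m" "found ?c t' q'"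
      then show "achievable t' q'"
        using found b(1) sound_rule_applies[OF b(1)] unfolding sound_def by blast
    qed
    moreover have "complete k ?c"
      using b(2) found unfolding complete_def by blast
    moreover have "\<forall>t'<n. \<forall>q'<m. (t', q') \<in> insert (t, q) S \<longrightarrow>
        card (up_set {..<n} r t') \<le> Suc k \<longrightarrow> achievable t' q' \<longrightarrow> found ?c t' q'"
      using b(3) found complete_rule_applies[OF b(2)] by blast
    ultimately show ?thesis unfolding P_def by blast
  qed
  have round: "P k ({..<L} \<times> {..<L}) (sem I (Loop 1 (Loop 2 UPDATE)) \<sigma> b)" if "P k {} b" for k b \<sigma>
    unfolding sem.simps(4)[of I 1]
  proof (rule fold_upt_induct[where P = "\<lambda>i. P k ({..<i} \<times> {..<L})"])
    show "P k ({..<0} \<times> {..<L}) b" using that by simp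
    fix i b assume b: "P k ({..<i} \<times> {..<L}) b"
    have "P k ({..<i} \<times> {..<L} \<union> {i} \<times> {..<L}) (sem I (Loop 2 UPDATE) (\<sigma>(1 := i)) b)"
      unfolding sem.simps(4)
    proof (rule fold_upt_induct[where P = "\<lambda>j. P k ({..<i} \<times> {..<L} \<union> {i} \<times> {..<j})"])
      fix j c assume "j < L" "P k ({..<i} \<times> {..<L} \<union> {i} \<times> {..<j}) c"
      then have "P k (insert (i, j) ({..<i} \<times> {..<L} \<union> {i} \<times> {..<j})) (sem I UPDATE (\<sigma>(1 := i, 2 := j)) c)"
        by (intro step) auto
      then show "P k ({..<i} \<times> {..<L} \<union> {i} \<times> {..<Suc j}) (sem I UPDATE (\<sigma>(1 := i, 2 := j)) c)"
        by (simp add: lessThan_Suc)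
    qed (use b in simp)
    moreover have "{..<i} \<times> {..<L} \<union> {i} \<times> {..<L} = {..<Suc i} \<times> {..<L}" by auto
    ultimately show "P k ({..<Suc i} \<times> {..<L}) (sem I (Loop 2 UPDATE) (\<sigma>(1 := i)) b)" by simp
  qed
  have "P L {} (sem I FILL_TABLE \<sigma> a)"
    unfolding FILL_TABLE_def sem.simps(4)[of I 0]
  proof (rule fold_upt_induct[where P = "\<lambda>k. P k {}"])
    \<comment> \<open>No upset of a point is empty, so \<open>complete 0\<close> holds vacuously for
      the zero array.\<close>
    have "card (up_set {..<n} r t) \<noteq> 0" if "t < n" for t
      using up_set_self[OF po, of t] that by (auto simp: up_set_def)
    then show "P 0 {} a" using assms(1) by (fastforce simp: P_def sound_def complete_def)
    fix k b assume "P k {} b"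
    from round[OF this, of "\<sigma>(0 := k)"] bounds(1,2)
    show "P (Suc k) {} (sem I (Loop 1 (Loop 2 UPDATE)) (\<sigma>(0 := k)) b)"
      by (simp add: P_def complete_def)
  qed
  moreover have "card (up_set {..<n} r t) \<le> L"
  proof -
    have "card (up_set {..<n} r t) \<le> card {..<n}" by (intro card_mono) (auto simp: up_set_def)
    then show ?thesis using bounds(1) by simp
  qed
  ultimately show ?thesis using assms(2,3) by (auto simp: P_def sound_def complete_def)
qed

lemma bounded_quantifiers:
  "(\<exists>i<L. i < n \<and> P i) \<longleftrightarrow> (\<exists>i<n. P i)" "(\<exists>i<L. i < m \<and> P i) \<longleftrightarrow> (\<exists>i<m. P i)"
  "(\<forall>i<L. i < n \<longrightarrow> P i) \<longleftrightarrow> (\<forall>i<n. P i)" "(\<forall>i<L. i < m \<longrightarrow> P i) \<longleftrightarrow> (\<forall>i<m. P i)"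
  using bounds(1,2) less_trans by blast+

lemma tr_SPMORPH:
  assumes "\<And>t q. t < n \<Longrightarrow> q < m \<Longrightarrow> found a t q \<longleftrightarrow> achievable t q"
  shows "tr I SPMORPH \<sigma> a \<longleftrightarrow> has_surj_p_morphism {..<n} r {..<m} s"
proof -
  note po = finite_treeD(1)[OF tree]
  obtain root where root: "root < n" "\<And>t. t < n \<Longrightarrow> (root, t) \<in> r" using finite_treeD(2)[OF tree] by auto
  have "tr I SPMORPH \<sigma> a \<longleftrightarrow> (\<exists>t<n. (\<forall>x<n. (t, x) \<in> r) \<and> (\<exists>q<m. (\<forall>y<m. (q, y) \<in> s) \<and> achievable t q))"
    using assms
    by (simp add: SPMORPH_def tr_REL_T tr_REL_Q tval_ENTRY bounded_quantifiers cong: conj_cong imp_cong)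
  \<comment> \<open>By antisymmetry the root is the only t below all points.\<close>
  also have "\<dots> \<longleftrightarrow> (\<exists>q<m. (\<forall>y<m. (q, y) \<in> s) \<and> achievable root q)"
    using root finite_posetD(4)[OF po] by metis
  finally show ?thesis using has_surj_p_morphism_iff[OF po poset, of root] root by auto
qed

lemma tr_LOGCONTAIN:
  assumes "\<And>t q. t < n \<Longrightarrow> q < m \<Longrightarrow> found a t q \<longleftrightarrow> achievable t q"
  shows "tr I LOGCONTAIN \<sigma> a \<longleftrightarrow> logic {..<n} r \<subseteq> logic {..<m} s"
proof -
  note po = finite_treeD(1)[OF tree]
  have "tr I LOGCONTAIN \<sigma> a \<longleftrightarrow> (\<forall>q<m. \<exists>t<n. achievable t q)"
    using assms by (simp add: LOGCONTAIN_def tval_ENTRY bounded_quantifiers cong: conj_cong imp_cong)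
  then show ?thesis using logic_subset_iff[OF po poset] by auto
qed

lemma sem_DECIDE:
  "sem I DECIDE \<sigma> (\<lambda>_. 0) 0 = of_bool (has_surj_p_morphism {..<n} r {..<m} s)"
  "sem I DECIDE \<sigma> (\<lambda>_. 0) 1 = of_bool (logic {..<n} r \<subseteq> logic {..<m} s)"
proof -
  note fill = sem_FILL_TABLE[of "\<lambda>_. 0", OF refl]
  let ?a = "sem I FILL_TABLE \<sigma> (\<lambda>_. 0)"
  \<comment> \<open>Cell 0 lies below the table, so writing the first answer there does not disturb
    the evaluation of the second.\<close>
  have "found (?a(0 := v)) t q \<longleftrightarrow> achievable t q" if "t < n" "q < m" for v t q
    using fill[OF that] bounds(1) by simp
  then show "sem I DECIDE \<sigma> (\<lambda>_. 0) 0 = of_bool (has_surj_p_morphism {..<n} r {..<m} s)"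
    "sem I DECIDE \<sigma> (\<lambda>_. 0) 1 = of_bool (logic {..<n} r \<subseteq> logic {..<m} s)"
    using tr_SPMORPH[OF fill] tr_LOGCONTAIN by (simp_all add: DECIDE_def)
qed

end

theorem theorem5:
  shows "\<exists>c. computes_in_poly_time c
    {((n, r), (m, s)). finite_tree {..<n} r \<and> finite_poset {..<m} s}
    encode_pair
    (\<lambda>((n, r), (m, s)). [has_surj_p_morphism {..<n} r {..<m} s,
                         logic {..<n} r \<subseteq> logic {..<m} s])"
proof -
  let ?D = "{((n, r), (m, s)). finite_tree {..<n} r \<and> finite_poset {..<m} s}"
  let ?f = "\<lambda>((n, r), (m, s)). has_surj_p_morphism {..<n} r {..<m} s"
  let ?g = "\<lambda>((n, r), (m, s)). logic {..<n} r \<subseteq> logic {..<m} s"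
  have decide: "sem (load (encode_pair x)) DECIDE (\<lambda>_. 0) (\<lambda>_. 0) 0 = of_bool (?f x) \<and>
      sem (load (encode_pair x)) DECIDE (\<lambda>_. 0) (\<lambda>_. 0) 1 = of_bool (?g x)" if x: "x \<in> ?D" for x
  proof -
    obtain n r m s where x_eq: "x = ((n, r), (m, s))" by (metis prod.exhaust)
    with x interpret instance_pair n m r s by unfold_locales auto
    show ?thesis using sem_DECIDE unfolding I_def x_eq by simp
  qed
  have eq: "(\<lambda>((n, r), (m, s)). [has_surj_p_morphism {..<n} r {..<m} s,
      logic {..<n} r \<subseteq> logic {..<m} s]) = (\<lambda>x. [?f x, ?g x])"
    by auto
  show ?thesis
    unfolding eq by (rule prog_computes_in_poly_time[OF conjunct1[OF decide] conjunct2[OF decide]])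
qed

end
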